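(* Let $d\ge 1$ and let $X$ be a $d$-dimensional fake weighted projective space with at worst canonical singularities. Let $\operatorname{mult}X$ denote its multiplicity and let $(s_i)_{i\ge1}$ be the Sylvester sequence. (i) If $d\le 3$, then $\operatorname{mult}X\le (d+1)^{d-1}$. For each such $d$ there is, up to isomorphism, exactly one $X$ for which equality holds, and it is of the form $X\cong\mathbb{P}^d/G$. (ii) If $d=4$, then $\operatorname{mult}X\le 128$. There is, up to isomorphism, exactly one $X$ for which equality holds, and it is of the form $X\cong\mathbb{P}(4,1,1,1,1)/G$. (iii) If $d\ge 5$, then $\operatorname{mult}X\le 3(s_{d-1}-1)^2$. For each such $d$ there is, up to isomorphism, exactly one $X$ for which equality holds, and it is of the form $$X\cong\mathbb{P}\left(\frac{3(s_{d-1}-1)}{s_1},\ldots,\frac{3(s_{d-1}-1)}{s_{d-2}},1,1,1\right)/G.$$ In each case $G$ denotes a finite abelian group acting freely in codimension one (the group $N/N'$ of the definition of fake weighted projective space), whose order is $\operatorname{mult}X$.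
   Context: The Sylvester sequence is defined by $s_1:=2$ and $s_i:=s_1\cdots s_{i-1}+1$ for $i\ge2$. Let $N\cong\mathbb{Z}^d$ be a lattice and $N_{\mathbb{Q}}:=N\otimes_{\mathbb{Z}}\mathbb{Q}$. A Fano simplex is a $d$-dimensional simplex $P=\operatorname{conv}\{v_0,\ldots,v_d\}\subset N_{\mathbb{Q}}$ whose vertices are primitive points of $N$ and which contains the origin in its strict interior. Its (reduced) weights are the unique coprime positive integers $(\lambda_0,\ldots,\lambda_d)$ with $\lambda_0v_0+\cdots+\lambda_dv_d=0$. Its spanning fan is the complete fan in $N$ whose maximal cones are the cones over the facets of $P$. A fake weighted projective space is a $\mathbb{Q}$-factorial complete normal toric variety of Picard rank one. Concretely, it is the toric variety $X$ of the spanning fan of a Fano simplex $P$. If $N':=\mathbb{Z}v_0+\cdots+\mathbb{Z}v_d\subset N$ is the sublattice generated by the vertices and $G:=N/N'$ (a finite abelian group), then $X=\mathbb{P}(\lambda_0,\ldots,\lambda_d)/G$, where $G$ acts freely in codimension one. The multiplicity of $X$ is $\operatorname{mult}X:=|G|=[N:N']$. Two such varieties are isomorphic if and only if the corresponding Fano simplices differ by an element of $\mathrm{GL}(N)$. The variety $X$ has at worst canonical singularities if and only if the origin is the only point of $N$ in the interior of $P$. *)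

theory Defs
  imports
    "HOL-Analysis.Analysis"
    "HOL-Algebra.Generated_Groups"
    "HOL-Library.Multiset"
begin

text \<open>
  Toric varieties are not available as geometric objects, so a fake weighted projective space
  is represented by the Fano simplex whose spanning fan defines it.  The
  lattice \<open>N\<close> is \<open>\<int>\<^sup>d\<close>, the set of integral points of \<open>real ^ 'n\<close>, with \<open>d = CARD('n)\<close>.
  Polytopes live in \<open>N \<otimes> \<real>\<close> instead of \<open>N \<otimes> \<rat>\<close>, so that the library's convex hulls and
  interiors apply; their vertices are lattice points.
\<close>

fun sylvester :: "nat \<Rightarrow> nat" where
  "sylvester i = (if i \<le> 1 then 2 else (\<Prod>j\<in>{1..<i}. sylvester j) + 1)"

declare sylvester.simps [simp del]


section \<open>Fano simplices\<close>

definition lattice_points :: "(real ^ 'n) set" where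
  "lattice_points = {x. \<forall>i. x $ i \<in> \<int>}"

text \<open>The origin is not primitive, as \<open>0 = 2 *\<^sub>R 0\<close>.\<close>

definition primitive_point :: "real ^ 'n \<Rightarrow> bool" where
  "primitive_point v \<longleftrightarrow>
     v \<in> lattice_points \<and> (\<forall>u\<in>lattice_points. \<forall>k::nat. v = real k *\<^sub>R u \<longrightarrow> k = 1)"

definition vertices :: "(real ^ 'n) set \<Rightarrow> (real ^ 'n) set" where
  "vertices P = {v. v extreme_point_of P}"

definition fano_simplex :: "(real ^ 'n::finite) set \<Rightarrow> bool" where
  "fano_simplex P \<longleftrightarrow>
     int CARD('n) simplex P \<and> (\<forall>v\<in>vertices P. primitive_point v) \<and> 0 \<in> interior P"

text \<open>The second conjunct says that the toric variety has at worst canonical singularities.\<close>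

definition canonical_fano_simplex :: "(real ^ 'n::finite) set \<Rightarrow> bool" where
  "canonical_fano_simplex P \<longleftrightarrow> fano_simplex P \<and> interior P \<inter> lattice_points = {0}"

text \<open>Isomorphism of the associated varieties: the simplices differ by an element of \<open>GL(N)\<close>.\<close>

definition fwps_isomorphic :: "(real ^ 'n::finite) set \<Rightarrow> (real ^ 'n) set \<Rightarrow> bool" where
  "fwps_isomorphic P Q \<longleftrightarrow>
     (\<exists>f. linear f \<and> bij f \<and> f ` lattice_points = lattice_points \<and> f ` P = Q)"


section \<open>Multiplicity\<close>

definition lattice_group :: "(real ^ 'n) monoid" where
  "lattice_group = \<lparr>carrier = lattice_points, mult = (+), one = 0\<rparr>"

definition vertex_sublattice :: "(real ^ 'n) set \<Rightarrow> (real ^ 'n) set" where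
  "vertex_sublattice P = generate lattice_group (vertices P)"

definition quotient_group :: "(real ^ 'n) set \<Rightarrow> (real ^ 'n) set monoid" where
  "quotient_group P = lattice_group Mod vertex_sublattice P"

text \<open>
  \<^const>\<open>order\<close> would be \<open>0\<close> for an infinite group, but \<open>finite_quotient_group\<close> below shows that
  the quotient group of a Fano simplex is finite.
\<close>

definition fwps_multiplicity :: "(real ^ 'n) set \<Rightarrow> nat" where
  "fwps_multiplicity P = order (quotient_group P)"


lemma comm_group_lattice: "comm_group (lattice_group :: (real ^ 'n) monoid)"
proof (rule comm_groupI)
  fix x :: "real ^ 'n"
  assume "x \<in> carrier lattice_group"
  then show "\<exists>y\<in>carrier lattice_group. y \<otimes>\<^bsub>lattice_group\<^esub> x = \<one>\<^bsub>lattice_group\<^esub>"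
    by (intro bexI[of _ "- x"]) (auto simp: lattice_group_def lattice_points_def)
qed (auto simp: lattice_group_def lattice_points_def)

lemma finite_quotient_group:
  fixes P :: "(real ^ 'n::finite) set"
  assumes "fano_simplex P"
  shows "finite (carrier (quotient_group P))"
proof -
  obtain C where C: "\<not> affine_dependent C" "P = convex hull C"
    using assms by (auto simp: fano_simplex_def simplex_def)
  have finC: "finite C"
    using C(1) by (simp add: aff_independent_finite)
  have V: "vertices P = C"
    using C by (auto simp: vertices_def extreme_point_of_convex_hull_affine_independent)
  have "interior P \<noteq> {}"
    using assms by (auto simp: fano_simplex_def)
  then have "affine hull C = UNIV"
    using affine_hull_nonempty_interior[of P] C(2) by simp
  then have span: "span C = UNIV"
    using affine_hull_subset_span[of C] by auto
  interpret L: comm_group "lattice_group :: (real ^ 'n) monoid"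
    by (rule comm_group_lattice)
  have CL: "C \<subseteq> carrier lattice_group"
    using assms V by (auto simp: fano_simplex_def primitive_point_def lattice_group_def)
  define H where "H = vertex_sublattice P"
  have "subgroup H lattice_group"
    using CL V by (simp add: H_def vertex_sublattice_def L.generate_is_subgroup)
  then interpret H: subgroup H lattice_group .
  have HL: "H \<subseteq> lattice_points"
    using H.subset by (simp add: lattice_group_def)
  have CH: "C \<subseteq> H"
    using V by (auto simp: H_def vertex_sublattice_def intro: generate.incl)
  have zero: "0 \<in> H"
    using H.one_closed by (simp add: lattice_group_def)
  have add: "x + y \<in> H" if "x \<in> H" "y \<in> H" for x y
    using H.m_closed that by (auto simp: lattice_group_def)
  have minus: "- x \<in> H" if "x \<in> H" for x
  proof -
    have "inv\<^bsub>lattice_group\<^esub> x = - x"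
      using that HL by (intro L.inv_equality) (auto simp: lattice_group_def lattice_points_def)
    then show ?thesis
      using H.m_inv_closed[OF that] by simp
  qed
  have nat_mult: "real k *\<^sub>R x \<in> H" if "x \<in> H" for k x
    by (induction k) (auto simp: zero add that algebra_simps)
  have int_mult: "of_int k *\<^sub>R x \<in> H" if "x \<in> H" for k :: int and x
    using nat_mult[OF that] minus[OF nat_mult[OF that]]
    by (cases k) (simp_all add: minus nat_mult that del: of_nat_Suc)
  have sum_in: "sum g A \<in> H" if "finite A" "\<And>a. a \<in> A \<Longrightarrow> g a \<in> H" for g and A :: "(real ^ 'n) set"
    using that by (induction A rule: finite_induct) (auto simp: zero add)
  define R where "R = (\<Sum>v\<in>C. norm v)"
  define S where "S = {x :: real ^ 'n. \<forall>i. x $ i \<in> {k. k \<in> \<int> \<and> \<bar>k\<bar> \<le> R}}"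
  have "finite (PiE (UNIV :: 'n set) (\<lambda>_. {k :: real. k \<in> \<int> \<and> \<bar>k\<bar> \<le> R}))"
    by (intro finite_PiE) (auto simp: finite_abs_int_segment)
  then have "finite (vec_lambda ` (PiE (UNIV :: 'n set) (\<lambda>_. {k :: real. k \<in> \<int> \<and> \<bar>k\<bar> \<le> R})))"
    by (rule finite_imageI)
  moreover have "S \<subseteq> vec_lambda ` (PiE (UNIV :: 'n set) (\<lambda>_. {k :: real. k \<in> \<int> \<and> \<bar>k\<bar> \<le> R}))"
  proof
    fix x assume "x \<in> S"
    then show "x \<in> vec_lambda ` (PiE (UNIV :: 'n set) (\<lambda>_. {k :: real. k \<in> \<int> \<and> \<bar>k\<bar> \<le> R}))"
      by (intro image_eqI[of _ _ "vec_nth x"]) (auto simp: S_def)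
  qed
  ultimately have "finite S"
    by (rule rev_finite_subset)
  moreover have "carrier (quotient_group P) \<subseteq> (\<lambda>r. H #>\<^bsub>lattice_group\<^esub> r) ` S"
  proof
    fix K assume "K \<in> carrier (quotient_group P)"
    then obtain x where x: "x \<in> lattice_points" "K = H #>\<^bsub>lattice_group\<^esub> x"
      by (auto simp: quotient_group_def FactGroup_def RCOSETS_def H_def lattice_group_def)
    obtain u where u: "x = (\<Sum>v\<in>C. u v *\<^sub>R v)"
      using span unfolding span_finite[OF finC] by blast
    define y where "y = (\<Sum>v\<in>C. of_int \<lfloor>u v\<rfloor> *\<^sub>R v)"
    define r where "r = (\<Sum>v\<in>C. frac (u v) *\<^sub>R v)"
    have y: "y \<in> H"
      unfolding y_def using finC CH by (intro sum_in int_mult) auto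
    have xyr: "x = y + r"
      by (simp add: u y_def r_def frac_def algebra_simps flip: sum.distrib)
    have "norm r \<le> R"
      unfolding r_def R_def
      by (intro sum_norm_le) (auto simp: frac_ge_0 frac_lt_1 less_imp_le mult_left_le_one_le)
    then have "\<bar>r $ i\<bar> \<le> R" for i
      using component_le_norm_cart[of r i] by linarith
    moreover have rL: "r \<in> lattice_points"
    proof -
      have "r = x - y" using xyr by simp
      then show ?thesis using x y HL by (auto simp: lattice_points_def)
    qed
    ultimately have "r \<in> S"
      by (auto simp: S_def lattice_points_def)
    moreover have "K = H #>\<^bsub>lattice_group\<^esub> r"
    proof -
      have "x \<in> H #>\<^bsub>lattice_group\<^esub> r"
        using xyr y by (auto simp: r_coset_def lattice_group_def)
      then show ?thesis
        using L.repr_independence[OF _ _ \<open>subgroup H lattice_group\<close>, of x r] x(2) rL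
        by (simp add: lattice_group_def)
    qed
    ultimately show "K \<in> (\<lambda>r. H #>\<^bsub>lattice_group\<^esub> r) ` S"
      by blast
  qed
  ultimately show ?thesis
    by (rule finite_surj)
qed


section \<open>Weights and quotients of weighted projective spaces\<close>

definition reduced_weights :: "(real ^ 'n) set \<Rightarrow> (real ^ 'n \<Rightarrow> nat) \<Rightarrow> bool" where
  "reduced_weights P w \<longleftrightarrow>
     (\<forall>v\<in>vertices P. 0 < w v) \<and> Gcd (w ` vertices P) = 1 \<and>
     (\<Sum>v\<in>vertices P. real (w v) *\<^sub>R v) = 0"

text \<open>
  \<open>G = N/N'\<close> acts on the weighted projective space of the fan in \<open>N'\<close>.  The elements of \<open>G\<close> fixing
  the torus-invariant prime divisor of a vertex \<open>v\<close> pointwise are the classes of the lattice points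
  on the line through \<open>v\<close>.  The action is free on the torus, so it is free in codimension one iff
  all these classes are trivial.
\<close>

definition free_in_codim_one :: "(real ^ 'n) set \<Rightarrow> bool" where
  "free_in_codim_one P \<longleftrightarrow>
     (\<forall>v\<in>vertices P. \<forall>t::real. t *\<^sub>R v \<in> lattice_points \<longrightarrow> t *\<^sub>R v \<in> vertex_sublattice P)"

text \<open>
  The variety of \<open>P\<close> is \<open>\<P>(ws)/G\<close> with \<open>G = N/N'\<close> finite abelian, acting freely in codimension one.
  Weighted projective spaces do not depend on the order of the weights.
\<close>

definition is_wps_quotient :: "(real ^ 'n) set \<Rightarrow> nat list \<Rightarrow> bool" where
  "is_wps_quotient P ws \<longleftrightarrow>
     (\<exists>w. reduced_weights P w \<and> image_mset w (mset_set (vertices P)) = mset ws) \<and>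
     comm_group (quotient_group P) \<and> finite (carrier (quotient_group P)) \<and>
     free_in_codim_one P"

text \<open>For \<open>d \<ge> 5\<close>; the divisions are exact, since \<open>s\<^bsub>d-1\<^esub> - 1 = s\<^sub>1 \<cdots> s\<^bsub>d-2\<^esub>\<close>.\<close>

definition sylvester_weights :: "nat \<Rightarrow> nat list" where
  "sylvester_weights d =
     map (\<lambda>i. 3 * (sylvester (d - 1) - 1) div sylvester i) [1..<d - 1] @ [1, 1, 1]"

end

theory Submission
  imports Defs "HOL-Algebra.Multiplicative_Group" "HOL-Number_Theory.Cong"
begin

text \<open>
  Let \<open>b\<^sub>0 \<ge> \<dots> \<ge> b\<^sub>d\<close> be the barycentric coordinates \<open>\<lambda>\<^sub>i / h\<close> of the origin.  A lattice point whose
  coordinates differ from these by less than \<open>b\<^sub>i\<close>, with at most one exception, is the origin: it or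
  its negative lies in the interior of the simplex.  Hence boxes with side lengths \<open>b\<^sub>i\<close> around the
  lattice points are disjoint.  In the span of the first \<open>j\<close> vertices this gives
  \<open>b\<^sub>0 \<cdots> b\<^sub>j\<^sub>-\<^sub>1 \<le> b\<^sub>j + \<cdots> + b\<^sub>d\<close>, and in the whole space \<open>mult \<cdot> \<lambda>\<^sub>0 \<cdots> \<lambda>\<^sub>d\<^sub>-\<^sub>1 \<le> h ^ (d - 1)\<close>.
  So \<open>mult\<close> is at most the inverse of \<open>b\<^sub>0 \<cdots> b\<^sub>d\<^sub>-\<^sub>2\<close>, which is minimised under the former inequalities;
  the minimum starts with inverse Sylvester numbers and continues with equal terms.

  If the bound is attained, the boxes tile the space.  Together with the Chinese remainder theorem
  for the Sylvester numbers this shows that the lattice consists of all points whose \<open>i\<close>-th coordinate is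
  an integral multiple of \<open>b\<^sub>i\<close>, so the simplex is unique.
\<close>

section \<open>Sequences with bounded partial products\<close>

text \<open>The weight of index \<open>d - 1\<close> is at least 1, so the packing bound for
  \<open>mult\<close> loses only that factor; a simplex attaining the final bound ends in two
  weights 1. The remaining product lacks the two smallest terms, and for \<open>b (d - 2)\<close>
  only monotonicity counts: it is at least a third of the sum of the last three terms. This makes
  the extremal sequence leave the Sylvester pattern, and the dimension decides where. Let t be the
  product of the first \<open>d - 3\<close> Sylvester numbers. If the pattern is kept for
  \<open>d - 2\<close> terms, the product is 1 / (3 * t^2 * (t + 1)^2); if it stops after
  \<open>d - 3\<close> terms and the remainder 1 / t is cut into four equal parts, it is 1 / (16 *
  t^3). The former is smaller exactly if 16 * t < 3 * (t + 1)^2, that is, t > 3. The values t = 1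
  and t = 2 belong to \<open>d = 3\<close> and \<open>d = 4\<close>, which explains the separate
  cases and the constants 16 and 128. Residues are counted in place of volumes: a packing without
  gaps is then an injection between finite sets of equal size, so the tiling is immediate.\<close>

definition sylvester_prod :: "nat \<Rightarrow> nat" where
  "sylvester_prod k = (\<Prod>j\<in>{1..k}. sylvester j)"

lemma sylvester_Suc: "sylvester (Suc k) = sylvester_prod k + 1"
  by (cases k) (simp_all add: sylvester.simps[of "Suc _"] sylvester_prod_def atLeastLessThanSuc_atLeastAtMost)

lemma sylvester_prod_0 [simp]: "sylvester_prod 0 = 1"
  by (simp add: sylvester_prod_def)

lemma sylvester_prod_Suc: "sylvester_prod (Suc k) = sylvester_prod k * (sylvester_prod k + 1)"
  by (simp add: sylvester_prod_def sylvester_Suc[unfolded sylvester_prod_def] mult.commute)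

lemma sylvester_prod_pos: "0 < sylvester_prod k"
  by (induction k) (simp_all add: sylvester_prod_Suc)

lemma sylvester_prod_ge_6: "2 \<le> k \<Longrightarrow> 6 \<le> sylvester_prod k"
proof (induction k rule: dec_induct)
  case base
  show ?case by (simp add: sylvester_prod_Suc numeral_2_eq_2)
next
  case (step k)
  have "6 * 1 \<le> sylvester_prod k * (sylvester_prod k + 1)"
    using step by (intro mult_mono) auto
  then show ?case by (simp add: sylvester_prod_Suc)
qed

text \<open>What the first \<open>k\<close> inverse Sylvester numbers leave of 1, and at the same
  time their product: these numbers satisfy every product-sum inequality with equality. Sylvester
  numbers are indexed from 1 and sequences from 0, hence \<open>sylvester (Suc i)\<close>
  below.\<close>

definition sylvester_rest :: "nat \<Rightarrow> real" where
  "sylvester_rest k = 1 / real (sylvester_prod k)"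

lemma sylvester_rest_pos: "0 < sylvester_rest k"
  by (simp add: sylvester_rest_def sylvester_prod_pos)

lemma sylvester_rest_0 [simp]: "sylvester_rest 0 = 1"
  by (simp add: sylvester_rest_def)

lemma sylvester_rest_Suc: "sylvester_rest (Suc k) = sylvester_rest k / real (sylvester (Suc k))"
  by (simp add: sylvester_rest_def sylvester_prod_Suc sylvester_Suc algebra_simps)

lemma sylvester_rest_diff: "sylvester_rest k - sylvester_rest (Suc k) = 1 / real (sylvester (Suc k))"
proof -
  define t where "t = real (sylvester_prod k)"
  have "0 < t" using sylvester_prod_pos[of k] by (simp add: t_def)
  then have "1 / t - 1 / (t * (t + 1)) = 1 / (t + 1)"
    by (simp add: divide_simps)
  then show ?thesis
    by (simp add: sylvester_rest_def sylvester_prod_Suc sylvester_Suc t_def algebra_simps)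
qed

lemma prod_inverse_sylvester: "(\<Prod>i<k. 1 / real (sylvester (Suc i))) = sylvester_rest k"
  by (induction k) (simp_all add: sylvester_rest_Suc)

lemma sum_inverse_sylvester: "(\<Sum>i<k. 1 / real (sylvester (Suc i))) = 1 - sylvester_rest k"
proof (induction k)
  case (Suc k)
  then show ?case using sylvester_rest_diff[of k] by simp
qed simp

section \<open>Inequalities behind the choice of the tail\<close>

lemma pow2_gt_quadratic:
  assumes "2 \<le> m"
  shows "(m + 3) * (m + 4) < (2::nat) ^ (m + 3)"
  using assms
proof (induction m rule: dec_induct)
  case (step m)
  have "(Suc m + 3) * (Suc m + 4) \<le> 2 * ((m + 3) * (m + 4))"
    by (simp add: algebra_simps)
  also have "\<dots> < 2 * 2 ^ (m + 3)" using step by simp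
  finally show ?case by (simp add: power_add)
qed simp

text \<open>The function rises up to \<open>1 / (m + 1)\<close> and then falls, so its infimum is at
  an end of the interval; the right end gives the bound and is excluded. In the induction the old
  interval gains a factor \<open>1 - x\<close> above 1/2, and Bernoulli's inequality treats the
  piece added on the left. For \<open>m = 1\<close> the left end would give 3/16 < 1/4, hence
  \<open>2 \<le> m\<close>.\<close>

lemma split_product_gt:
  fixes x :: real
  assumes "2 \<le> m" "1 / (real m + 3) \<le> x" "x < 1/2"
  shows "1 / 2 ^ (m + 1) < x * (1 - x) ^ m"
  using assms
proof (induction m arbitrary: x rule: dec_induct)
  case base
  \<comment> \<open>The factor \<open>x - 1/2\<close> accounts for the excluded end; the smaller
    root of the quadratic factor is just below 1/5.\<close>
  have "(x - 1/2) * (x\<^sup>2 - 3/2 * x + 1/4) > 0"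
  proof (rule mult_neg_neg)
    have "(x - 1/5) * (x - 1/2) \<le> 0" using base by (intro mult_nonneg_nonpos) auto
    then have "x * x \<le> 7/10 * x - 1/10" by (simp add: algebra_simps)
    then show "x\<^sup>2 - 3/2 * x + 1/4 < 0" using base by (simp add: power2_eq_square)
  qed (use base in auto)
  then have "0 < x * (1 - x)^2 - 1/8" by (simp add: field_simps power2_eq_square)
  then show ?case by simp
next
  case (step m)
  show ?case
  proof (cases "1 / (real m + 3) \<le> x")
    case True
    have "1 / 2 ^ (m + 1) * (1 / 2) < (x * (1 - x) ^ m) * (1 - x)"
    proof (rule mult_strict_mono)
      have "0 < x" using step.prems(1) by (rule less_le_trans[rotated]) simp
      then show "0 < x * (1 - x) ^ m" using step.prems by simp
    qed (use step.IH[OF True] step.prems in auto)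
    then show ?thesis by (simp add: mult_ac)
  next
    case False
    have "2 / ((real m + 3) * (real m + 4)) = 1 / (real m + 4) * (1 - real (m + 1) * (1 / (real m + 3)))"
      by (simp add: field_simps)
    also have "\<dots> \<le> x * (1 - x) ^ (m + 1)"
    proof (rule mult_mono)
      have "1 - real (m + 1) * (1 / (real m + 3)) \<le> 1 + real (m + 1) * (- x)"
        using mult_left_mono[of x "1 / (real m + 3)" "real (m + 1)"] False by simp
      also have "\<dots> \<le> (1 + (- x)) ^ (m + 1)"
        by (rule Bernoulli_inequality) (use step.prems in auto)
      finally show "1 - real (m + 1) * (1 / (real m + 3)) \<le> (1 - x) ^ (m + 1)" by simp
      show "0 \<le> x" using step.prems(1) order_trans[of 0 "1 / (real (Suc m) + 3)" x] by simp
    qed (use step.prems in \<open>auto simp: field_simps\<close>)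
    finally have "2 / ((real m + 3) * (real m + 4)) \<le> x * (1 - x) ^ (m + 1)" .
    moreover have "1 / 2 ^ (Suc m + 1) < 2 / ((real m + 3) * (real m + 4))"
    proof -
      have "(real m + 3) * (real m + 4) < 2 ^ (m + 3)"
        using pow2_gt_quadratic[OF step.hyps(1)] of_nat_less_iff[of "(m+3)*(m+4)" "2^(m+3)", where 'a=real]
        by simp
      then have "2 / 2 ^ (m + 3) < 2 / ((real m + 3) * (real m + 4))"
        by (intro divide_strict_left_mono) auto
      then show ?thesis by (simp add: power_add)
    qed
    ultimately show ?thesis by simp
  qed
qed

text \<open>
  The infimum of \<open>x\<^sub>1 \<cdots> x\<^sub>m * r / 3\<close> over the tails with \<open>x\<^sub>1 + \<cdots> + x\<^sub>m + r = 1\<close> considered in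
  \<open>tail_product_ge\<close> below: halve \<open>m - 1\<close> times, then split the rest into four equal parts.
\<close>

fun tail_const :: "nat \<Rightarrow> real" where
  "tail_const 0 = 1 / 3"
| "tail_const (Suc 0) = 1 / 16"
| "tail_const (Suc (Suc m)) = tail_const (Suc m) / 2 ^ (m + 3)"

lemma tail_const_pos: "0 < tail_const m"
  by (induction m rule: tail_const.induct) auto

text \<open>Moving a term from the tail into the Sylvester head does not increase the product as
  long as the tail keeps a term, so a tail of one term is the best nonempty one. A single move
  amounts to \<open>t \<le> ((t + 1) / 2) ^ (m + 3)\<close>, which follows from the inequality of
  arithmetic and geometric means.\<close>

lemma tail_const_sylvester:
  assumes "k + Suc m = n"
  shows "sylvester_rest (n - 1) ^ 3 / 16 \<le> tail_const (Suc m) * sylvester_rest k ^ (m + 3)"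
  using assms
proof (induction m arbitrary: k)
  case 0
  then have "n - 1 = k" by auto
  then show ?case by simp
next
  case (Suc m)
  define t where "t = real (sylvester_prod k)"
  have t: "1 \<le> t" using sylvester_prod_pos[of k] by (simp add: t_def)
  have u: "sylvester_rest k = 1 / t" "sylvester_rest (Suc k) = 1 / (t * (t + 1))"
    by (simp_all add: sylvester_rest_def t_def sylvester_prod_Suc algebra_simps)
  have "t \<le> ((t + 1) / 2) ^ 2 * 1"
    using zero_le_power2[of "t - 1"] by (simp add: power2_eq_square field_simps)
  also have "\<dots> \<le> ((t + 1) / 2) ^ 2 * ((t + 1) / 2) ^ (m + 1)"
    using t by (intro mult_left_mono one_le_power) auto
  also have "\<dots> = ((t + 1) / 2) ^ (m + 3)" unfolding power_add[symmetric] by (rule arg_cong[where f = "power _"]) simp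
  finally have *: "t * 2 ^ (m + 3) \<le> (t + 1) ^ (m + 3)" by (simp add: power_divide field_simps)
  have "sylvester_rest (Suc k) ^ (m + 3) \<le> sylvester_rest k ^ (m + 4) / 2 ^ (m + 3)"
  proof -
    have "t * t ^ (m + 3) * 2 ^ (m + 3) \<le> t ^ (m + 3) * (t + 1) ^ (m + 3)"
      using mult_left_mono[OF *, of "t ^ (m+3)"] t by (simp add: mult_ac)
    then have "1 / (t ^ (m + 3) * (t + 1) ^ (m + 3)) \<le> 1 / (t * t ^ (m + 3) * 2 ^ (m + 3))"
      using t by (intro divide_left_mono) (auto intro!: mult_pos_pos)
    then show ?thesis
      by (simp add: u power_divide power_mult_distrib eval_nat_numeral mult_ac)
  qed
  then have "tail_const (Suc m) * sylvester_rest (Suc k) ^ (m + 3)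
      \<le> tail_const (Suc m) * (sylvester_rest k ^ (m + 4) / 2 ^ (m + 3))"
    by (intro mult_left_mono) (auto intro: less_imp_le tail_const_pos)
  also have "\<dots> = tail_const (Suc (Suc m)) * sylvester_rest k ^ (Suc m + 3)"
    by (simp add: add_ac)
  finally have "tail_const (Suc m) * sylvester_rest (Suc k) ^ (m + 3)
      \<le> tail_const (Suc (Suc m)) * sylvester_rest k ^ (Suc m + 3)" .
  then show ?case using Suc.IH[of "Suc k"] Suc.prems by linarith
qed

text \<open>After the reduction to a tail of one term, the inequality
  \<open>16 * t < 3 * (t + 1)^2\<close> remains; it fails for the partial products 1 and 2 and holds
  from 6 on, hence \<open>3 \<le> n\<close>.\<close>

lemma tail_const_sylvester_gt:
  assumes "k + m = n" "0 < m" "3 \<le> n"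
  shows "sylvester_rest n ^ 2 / 3 < tail_const m * sylvester_rest k ^ (m + 2)"
proof -
  obtain m' where m': "m = Suc m'" using assms by (cases m) auto
  obtain n' where n': "n = Suc n'" using assms by (cases n) auto
  define t where "t = real (sylvester_prod n')"
  have t: "6 \<le> t" using sylvester_prod_ge_6[of n'] assms n' by (simp add: t_def)
  have "0 < (3 * t - 1) * (t - 3)" using t by simp
  then have "16 * t < 3 * (t + 1)\<^sup>2" by (simp add: algebra_simps power2_eq_square)
  then have "16 * t ^ 3 < 3 * t^2 * (t + 1)\<^sup>2"
    using mult_strict_left_mono[of "16 * t" "3 * (t + 1)\<^sup>2" "t^2"] t
    by (simp add: power3_eq_cube power2_eq_square mult_ac)
  then have "1 / (3 * t^2 * (t + 1)\<^sup>2) < 1 / (16 * t ^ 3)"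
    using t by (intro divide_strict_left_mono) (auto intro!: mult_pos_pos)
  then have "sylvester_rest n ^ 2 / 3 < sylvester_rest (n - 1) ^ 3 / 16"
    unfolding sylvester_rest_def n' sylvester_prod_Suc of_nat_mult of_nat_add of_nat_1 t_def[symmetric]
    by (simp add: t_def[symmetric] power_divide power_mult_distrib mult_ac)
  also have "\<dots> \<le> tail_const m * sylvester_rest k ^ (m + 2)"
    using tail_const_sylvester[of k m' n] assms m' by (simp add: numeral_3_eq_3)
  finally show ?thesis .
qed

section \<open>Comparison of a nonincreasing sequence with the inverse Sylvester numbers\<close>

locale product_sum_sequence =
  fixes b :: "nat \<Rightarrow> real" and d :: nat
  assumes b_pos: "i \<le> d \<Longrightarrow> 0 < b i"
    and b_antimono: "i \<le> j \<Longrightarrow> j \<le> d \<Longrightarrow> b j \<le> b i"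
    and b_sum: "(\<Sum>i\<le>d. b i) = 1"
    and product_sum: "j \<le> d \<Longrightarrow> (\<Prod>i<j. b i) \<le> 1 - (\<Sum>i<j. b i)"
begin

definition rest :: "nat \<Rightarrow> real" where
  "rest j = 1 - (\<Sum>i<j. b i)"

lemma rest_0 [simp]: "rest 0 = 1"
  by (simp add: rest_def)

lemma rest_Suc: "rest (Suc j) = rest j - b j"
  by (simp add: rest_def)

lemma rest_eq: "j \<le> Suc d \<Longrightarrow> rest j = (\<Sum>i=j..d. b i)"
proof -
  assume "j \<le> Suc d"
  then have "{..d} = {..<j} \<union> {j..d}" by auto
  then have "(\<Sum>i\<le>d. b i) = (\<Sum>i<j. b i) + (\<Sum>i=j..d. b i)"
    by (simp add: sum.union_disjoint ivl_disj_int)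
  then show ?thesis using b_sum by (simp add: rest_def)
qed

lemma rest_pos: "j \<le> d \<Longrightarrow> 0 < rest j"
  by (subst rest_eq) (auto intro!: sum_pos b_pos)

text \<open>Summation by parts; the weights \<open>1 / b i\<close> increase.\<close>

lemma sum_ratio_ge:
  assumes "m \<le> d" "\<And>j. j \<le> m \<Longrightarrow> sylvester_rest j \<le> rest j"
  shows "(sylvester_rest (Suc m) - rest (Suc m)) / b m
      \<le> (\<Sum>i<Suc m. 1 - 1 / real (sylvester (Suc i)) / b i)"
  using assms
proof (induction m)
  case 0
  have "b 0 > 0" by (rule b_pos) simp
  then show ?case using sylvester_rest_diff[of 0] by (simp add: rest_Suc field_simps)
next
  case (Suc m)
  have pos: "0 < b (Suc m)" "b (Suc m) \<le> b m" using Suc.prems b_pos b_antimono by auto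
  have D: "sylvester_rest (Suc m) - rest (Suc m) \<le> 0" using Suc.prems by simp
  have "(sylvester_rest (Suc m) - rest (Suc m)) / b (Suc m) \<le> (sylvester_rest (Suc m) - rest (Suc m)) / b m"
    using D pos by (intro divide_left_mono_neg) auto
  also have "\<dots> \<le> (\<Sum>i<Suc m. 1 - 1 / real (sylvester (Suc i)) / b i)"
    using Suc by auto
  finally have *: "(sylvester_rest (Suc m) - rest (Suc m)) / b (Suc m)
     \<le> (\<Sum>i<Suc m. 1 - 1 / real (sylvester (Suc i)) / b i)" .
  have "(sylvester_rest (Suc (Suc m)) - rest (Suc (Suc m))) / b (Suc m)
     = (sylvester_rest (Suc m) - rest (Suc m)) / b (Suc m) + (1 - 1 / real (sylvester (Suc (Suc m))) / b (Suc m))"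
    using pos sylvester_rest_diff[of "Suc m"] by (simp add: rest_Suc field_simps)
  then show ?case using * by simp
qed

text \<open>By \<open>x \<le> exp (x - 1)\<close> for each ratio. It converts bounds on the sum of
  the ratios, which come from summation by parts, into bounds on their product.\<close>

lemma prod_ratio_le:
  assumes "k \<le> Suc d"
  shows "sylvester_rest k / (\<Prod>i<k. b i) \<le> exp (\<Sum>i<k. 1 / real (sylvester (Suc i)) / b i - 1)"
proof -
  have "sylvester_rest k / (\<Prod>i<k. b i) = (\<Prod>i<k. 1 / real (sylvester (Suc i)) / b i)"
    unfolding prod_inverse_sylvester[symmetric] by (simp only: prod_dividef)
  also have "\<dots> \<le> (\<Prod>i<k. exp (1 / real (sylvester (Suc i)) / b i - 1))"
  proof (rule prod_mono, intro conjI)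
    fix i assume "i \<in> {..<k}"
    then have "0 < b i" using assms by (auto intro: b_pos)
    then show "0 \<le> 1 / real (sylvester (Suc i)) / b i" by simp
    show "1 / real (sylvester (Suc i)) / b i \<le> exp (1 / real (sylvester (Suc i)) / b i - 1)"
      using exp_ge_add_one_self[of "1 / real (sylvester (Suc i)) / b i - 1"] by simp
  qed
  finally show ?thesis by (simp add: exp_sum)
qed

lemma prod_b_pos: "k \<le> Suc d \<Longrightarrow> 0 < (\<Prod>i<k. b i)"
  by (rule prod_pos) (auto intro: b_pos)

text \<open>At the least failing \<open>j\<close>, summation by parts makes the average of the
  ratios \<open>1 / sylvester (Suc i) / b i\<close> less than 1, hence also their product. Then the
  product of the \<open>b i\<close> exceeds \<open>sylvester_rest j\<close>, which contradicts the
  product-sum inequality.\<close>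

lemma sylvester_rest_le_rest: "j \<le> d \<Longrightarrow> sylvester_rest j \<le> rest j"
proof (induction j rule: less_induct)
  case (less j)
  show ?case
  proof (cases j)
    case (Suc m)
    show ?thesis
    proof (rule ccontr)
      assume less_rest: "\<not> ?thesis"
      have "0 < b m" using less Suc by (intro b_pos) auto
      then have "0 < (sylvester_rest j - rest j) / b m" using less_rest by simp
      also have "\<dots> \<le> (\<Sum>i<Suc m. 1 - 1 / real (sylvester (Suc i)) / b i)"
        unfolding Suc using less Suc by (intro sum_ratio_ge) auto
      finally have "(\<Sum>i<j. 1 / real (sylvester (Suc i)) / b i - 1) < 0"
        using Suc by (simp add: sum_subtractf)
      then have "exp (\<Sum>i<j. 1 / real (sylvester (Suc i)) / b i - 1) < 1" by simp
      then have "sylvester_rest j / (\<Prod>i<j. b i) < 1"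
        using prod_ratio_le[of j] less.prems by linarith
      then have "sylvester_rest j < (\<Prod>i<j. b i)"
        using prod_b_pos[of j] less.prems by simp
      then show False using product_sum[OF less.prems] less_rest by (simp add: rest_def)
    qed
  qed simp
qed

text \<open>The rest is treated as one more term: by the assumption on \<open>k\<close> the sequence
  \<open>b 0, ..., b (k - 1), rest k\<close> is still nonincreasing, with sum 1. It is compared with
  the inverse Sylvester numbers followed by \<open>sylvester_rest k\<close>, whose product is the
  left-hand side. Equality makes every use of \<open>x \<le> exp (x - 1)\<close> sharp, so all
  ratios are 1.\<close>

lemma prod_rest_ge:
  assumes "k \<le> d" "k = 0 \<or> rest k \<le> b (k - 1)"
  shows "sylvester_rest k ^ 2 \<le> (\<Prod>i<k. b i) * rest k"
    and "sylvester_rest k ^ 2 = (\<Prod>i<k. b i) * rest k \<Longrightarrow>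
      rest k = sylvester_rest k \<and> (\<forall>i<k. b i = 1 / real (sylvester (Suc i)))"
proof -
  let ?a = "\<lambda>i. 1 / real (sylvester (Suc i))"
  define P where "P = (\<Prod>i<k. b i)"
  define u where "u = sylvester_rest k"
  define S where "S = (\<Sum>i<k. ?a i / b i - 1)"
  have P: "0 < P" using assms by (auto simp: P_def intro: prod_b_pos)
  have u: "0 < u" by (simp add: u_def sylvester_rest_pos)
  have ur: "u \<le> rest k" using sylvester_rest_le_rest[OF assms(1)] by (simp add: u_def)
  have S: "S \<le> 1 - u / rest k"
  proof (cases k)
    case 0
    then show ?thesis by (simp add: S_def u_def)
  next
    case (Suc m)
    have "(u - rest k) / rest k \<le> (u - rest k) / b m"
      using assms Suc ur u by (intro divide_left_mono_neg) auto
    also have "\<dots> \<le> (\<Sum>i<k. 1 - ?a i / b i)"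
      unfolding Suc u_def using assms Suc by (intro sum_ratio_ge sylvester_rest_le_rest) auto
    finally show ?thesis using ur u by (simp add: S_def sum_subtractf diff_divide_distrib)
  qed
  have r: "0 < rest k" using ur u by simp
  have q: "u / rest k \<le> exp (- S)"
    using S exp_ge_add_one_self[of "-S"] by simp
  have PS: "u / P \<le> exp S"
    using prod_ratio_le[of k] assms by (simp add: u_def P_def S_def)
  have "(u / P) * (u / rest k) \<le> exp S * exp (- S)"
    using PS q u r P by (intro mult_mono) auto
  then have "u\<^sup>2 \<le> P * rest k" using P r by (simp add: exp_minus power2_eq_square field_simps)
  then show "sylvester_rest k ^ 2 \<le> (\<Prod>i<k. b i) * rest k" by (simp add: u_def P_def)
  assume "sylvester_rest k ^ 2 = (\<Prod>i<k. b i) * rest k"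
  then have "u * u = P * rest k" by (simp add: u_def P_def power2_eq_square)
  then have eq: "(u / P) * (u / rest k) = 1" using P r by (simp add: field_simps)
  have "exp S * exp (- S) = 1" by (simp add: exp_minus)
  moreover have "(u / P) * (u / rest k) < exp S * exp (- S)" if "u / rest k < exp (- S)"
    using PS that u r P by (intro mult_le_less_imp_less) auto
  ultimately have qe: "u / rest k = exp (- S)" using eq q by fastforce
  have S0: "S = 0"
  proof (rule ccontr)
    assume "S \<noteq> 0"
    then have "1 + (- S) < exp (- S)"
      using exp_minus_greater[of S] by (simp)
    then show False using S qe by simp
  qed
  then have "u = rest k" using qe r by simp
  have "b i = ?a i" if i: "i < k" for i
  proof (rule ccontr)
    assume "b i \<noteq> ?a i"
    have bp: "0 < b j" if "j < k" for j using that assms by (auto intro: b_pos)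
    have le: "?a j / b j \<le> exp (?a j / b j - 1)" for j
      using exp_ge_add_one_self[of "?a j / b j - 1"] by simp
    have "?a i / b i \<noteq> 1" using \<open>b i \<noteq> ?a i\<close> bp[OF i] by (metis divide_eq_1_iff less_irrefl)
    then have less: "?a i / b i < exp (?a i / b i - 1)"
    proof -
      have "r < exp (r - 1)" if "r \<noteq> 1" for r :: real
        using exp_minus_greater[of "1 - r"] that by simp
      then show ?thesis using \<open>?a i / b i \<noteq> 1\<close> by blast
    qed
    have "(\<Prod>i<k. ?a i / b i) < (\<Prod>i<k. exp (?a i / b i - 1))"
    proof (rule prod_mono_strict[of i])
      show "\<And>j. j \<in> {..<k} \<Longrightarrow> 0 \<le> ?a j / b j \<and> ?a j / b j \<le> exp (?a j / b j - 1)"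
        using le bp by (simp add: less_imp_le)
    qed (use i less in \<open>auto\<close>)
    then have "u / P < exp S"
      unfolding u_def P_def S_def prod_inverse_sylvester[symmetric] by (simp only: prod_dividef exp_sum finite_lessThan)
    then show False using eq \<open>u = rest k\<close> S0 r by simp
  qed
  then show "rest k = sylvester_rest k \<and> (\<forall>i<k. b i = ?a i)"
    using \<open>u = rest k\<close> u_def by simp
qed

end


section \<open>The minimal product and its equality case\<close>

definition head_length :: "nat \<Rightarrow> nat" where
  "head_length d = (if d \<le> 3 then 0 else if d = 4 then 1 else d - 2)"

text \<open>Inverses of the terms of the minimising sequence: the Sylvester head, then the remainder
  in equal parts. For \<open>d \<le> 3\<close> the head is empty and all terms are
  \<open>1 / (d + 1)\<close>; for \<open>d = 4\<close> they are 1/2 and four times 1/8.\<close>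

definition extremal_denominator :: "nat \<Rightarrow> nat \<Rightarrow> nat" where
  "extremal_denominator d i =
     (if i < head_length d then sylvester (Suc i)
      else (d + 1 - head_length d) * sylvester_prod (head_length d))"

text \<open>The inverse of the product of the first \<open>d - 1\<close> terms of the minimising
  sequence.\<close>

definition max_mult :: "nat \<Rightarrow> nat" where
  "max_mult d = sylvester_prod (head_length d) *
     ((d + 1 - head_length d) * sylvester_prod (head_length d)) ^ (d - 1 - head_length d)"

context product_sum_sequence
begin

text \<open>Each step splits off \<open>b k = x * rest k\<close>. This is the largest of
  \<open>m + 3\<close> terms and smaller than the sum of the others, so
  \<open>1 / (m + 3) \<le> x < 1/2\<close>. For \<open>m = 1\<close> the product increases with
  \<open>x\<close> and is minimal at 1/4; for larger \<open>m\<close> the infimum belongs to the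
  excluded value 1/2, so the inequality is strict.\<close>

lemma tail_product_ge:
  assumes "d = n + 2" "k + m = n" "\<And>j. k \<le> j \<Longrightarrow> j < n \<Longrightarrow> b j < rest (Suc j)"
  shows "tail_const m * rest k ^ (m + 1) \<le> (\<Prod>i=k..<n. b i) * (rest n / 3) \<and>
    (m = 1 \<longrightarrow> tail_const m * rest k ^ (m + 1) = (\<Prod>i=k..<n. b i) * (rest n / 3) \<longrightarrow> b k = rest k / 4) \<and>
    (2 \<le> m \<longrightarrow> tail_const m * rest k ^ (m + 1) < (\<Prod>i=k..<n. b i) * (rest n / 3))"
  using assms(2,3)
proof (induction m arbitrary: k)
  case 0
  then show ?case by simp
next
  case (Suc m)
  define r where "r = rest k"
  define x where "x = b k / r"
  have r: "0 < r" unfolding r_def using Suc.prems assms(1) by (intro rest_pos) auto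
  have bk: "b k = r * x" using r by (simp add: x_def)
  have rS: "rest (Suc k) = r * (1 - x)" by (simp add: rest_Suc bk r_def algebra_simps)
  have "b k < rest (Suc k)" using Suc.prems by auto
  then have "r * (2 * x) < r * 1" unfolding rS bk by (simp add: algebra_simps)
  then have x2: "x < 1 / 2" using r by simp
  have "r = (\<Sum>i=k..d. b i)"
    unfolding r_def using Suc.prems assms(1) by (intro rest_eq) auto
  also have "\<dots> \<le> (\<Sum>i=k..d. b k)"
    by (intro sum_mono b_antimono) auto
  also have "\<dots> = (real m + 4) * (r * x)"
    using Suc.prems assms(1) by (auto simp: bk algebra_simps)
  finally have "r * 1 \<le> r * ((real m + 4) * x)" by (simp add: mult_ac)
  then have "1 \<le> (real m + 4) * x" using r by simp
  then have x1: "1 / (real m + 4) \<le> x" by (simp add: field_simps)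
  have E: "(\<Prod>i=k..<n. b i) * (rest n / 3) = b k * ((\<Prod>i=Suc k..<n. b i) * (rest n / 3))"
    using Suc.prems by (subst prod.atLeast_Suc_lessThan) auto
  show ?case
  proof (cases m)
    case 0
    have n: "n = Suc k" using Suc.prems 0 by simp
    have "(\<Prod>i=k..<n. b i) * (rest n / 3) = r^2 * (x * (1 - x) / 3)"
      unfolding E by (simp add: n rS bk power2_eq_square)
    also have "x * (1 - x) / 3 = 1 / 16 + (x - 1/4) * (3/4 - x) / 3"
      by (simp add: field_simps)
    finally have *: "(\<Prod>i=k..<n. b i) * (rest n / 3) = r\<^sup>2 / 16 + r\<^sup>2 * ((x - 1/4) * (3/4 - x) / 3)"
      by (simp only: distrib_left mult_1_right times_divide_eq_right[of _ 1 16])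
    define z where "z = r\<^sup>2 * ((x - 1/4) * (3/4 - x) / 3)"
    have x1': "1/4 \<le> x" using x1 0 by simp
    then have "0 \<le> z" using x2 by (simp add: z_def)
    moreover have "b k = r / 4" if "z = 0"
      using that x2 r bk by (auto simp: z_def)
    ultimately show ?thesis
      using * 0 unfolding z_def[symmetric] by (auto simp: r_def[symmetric] power2_eq_square)
  next
    case (Suc m')
    have T: "0 < tail_const m * r ^ (m + 2)"
      using r by (intro mult_pos_pos tail_const_pos) auto
    have "tail_const (Suc m) * r ^ (Suc m + 1) = tail_const m * r ^ (m + 2) * (1 / 2 ^ (m + 2))"
      by (simp add: Suc power_add)
    also have "\<dots> < tail_const m * r ^ (m + 2) * (x * (1 - x) ^ (m + 1))"
      using split_product_gt[of "m + 1" x] x1 x2 Suc T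
      by (intro mult_strict_left_mono) (auto simp: add_ac)
    also have "\<dots> = b k * (tail_const m * rest (Suc k) ^ (m + 1))"
      unfolding bk rS power_mult_distrib by (simp add: mult_ac)
    also have "\<dots> \<le> b k * ((\<Prod>i=Suc k..<n. b i) * (rest n / 3))"
      using Suc.IH[of "Suc k"] Suc.prems assms(1) b_pos[of k]
      by (intro mult_left_mono) auto
    finally have "tail_const (Suc m) * rest k ^ (Suc m + 1) < (\<Prod>i=k..<n. b i) * (rest n / 3)"
      unfolding E r_def .
    then show ?thesis using Suc by auto
  qed
qed

text \<open>
  The greedy part of the sequence ends at \<open>k\<close>: up to there it is compared with the inverse
  Sylvester numbers, and after it each term is smaller than the sum of its successors.
\<close>

lemma truncated_product_ge:
  assumes d: "d = n + 2"
  obtains k m where "k + m = n"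
    and "tail_const m * sylvester_rest k ^ (m + 2) \<le> (\<Prod>i<n. b i) * (rest n / 3)"
    and "2 \<le> m \<Longrightarrow> tail_const m * sylvester_rest k ^ (m + 2) < (\<Prod>i<n. b i) * (rest n / 3)"
    and "tail_const m * sylvester_rest k ^ (m + 2) = (\<Prod>i<n. b i) * (rest n / 3) \<Longrightarrow>
      rest k = sylvester_rest k \<and> (\<forall>i<k. b i = 1 / real (sylvester (Suc i))) \<and>
      (m = 1 \<longrightarrow> b k = rest k / 4)"
proof -
  define Q where "Q k \<longleftrightarrow> k \<le> n \<and> (k = 0 \<or> rest k \<le> b (k - 1))" for k
  define k where "k = Greatest Q"
  have Q: "Q k"
    unfolding k_def by (rule GreatestI_nat[of Q 0 n]) (auto simp: Q_def)
  have max: "j \<le> k" if "Q j" for j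
    unfolding k_def using that by (rule Greatest_le_nat[of Q j n]) (auto simp: Q_def)
  have less: "b j < rest (Suc j)" if "k \<le> j" "j < n" for j
    using max[of "Suc j"] that by (force simp: Q_def)
  obtain m where m: "k + m = n" using Q by (auto simp: Q_def le_iff_add)
  define u where "u = sylvester_rest k"
  define r where "r = rest k"
  define P where "P = (\<Prod>i<k. b i)"
  define E where "E = (\<Prod>i=k..<n. b i) * (rest n / 3)"
  have PE: "(\<Prod>i<n. b i) * (rest n / 3) = P * E"
    using m prod.atLeastLessThan_concat[of 0 k n b] by (simp add: P_def E_def lessThan_atLeast0 mult_ac)
  have ur: "0 < u" "u \<le> r"
    using sylvester_rest_le_rest[of k] m d by (auto simp: u_def r_def sylvester_rest_pos)
  have P: "0 < P" unfolding P_def using m d by (intro prod_b_pos) auto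
  have Pr: "u\<^sup>2 \<le> P * r"
    using prod_rest_ge(1)[of k] Q d by (simp add: Q_def u_def r_def P_def)
  note E = tail_product_ge[OF d m less, folded E_def r_def]
  have T: "0 < tail_const m" by (rule tail_const_pos)
  \<comment> \<open>Three losses separate the two sides: \<open>rest k\<close> replaces
    \<open>sylvester_rest k\<close> in \<open>m\<close> factors (\<open>A\<close>), then the bounds
    for the head (\<open>B\<close>) and for the tail (\<open>D\<close>) are applied. The equality
    case is read off from \<open>B\<close> and \<open>D\<close>.\<close>
  have A: "tail_const m * u ^ (m + 2) \<le> tail_const m * r ^ m * u\<^sup>2"
  proof -
    have "u ^ m * u\<^sup>2 \<le> r ^ m * u\<^sup>2" using ur by (intro mult_right_mono power_mono) auto
    then show ?thesis unfolding power_add mult.assoc using T by (intro mult_left_mono) auto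
  qed
  have B: "tail_const m * r ^ m * u\<^sup>2 \<le> tail_const m * r ^ m * (P * r)"
    using T ur Pr by (intro mult_left_mono) auto
  have C: "tail_const m * r ^ m * (P * r) = P * (tail_const m * r ^ (m + 1))"
    by simp
  have D: "P * (tail_const m * r ^ (m + 1)) \<le> P * E"
    using E P by simp
  show ?thesis
  proof (rule that[OF m])
    show "tail_const m * sylvester_rest k ^ (m + 2) \<le> (\<Prod>i<n. b i) * (rest n / 3)"
      unfolding PE u_def[symmetric] using A B C D by linarith
    show "tail_const m * sylvester_rest k ^ (m + 2) < (\<Prod>i<n. b i) * (rest n / 3)" if "2 \<le> m"
    proof -
      have "P * (tail_const m * r ^ (m + 1)) < P * E" using E P that by simp
      then show ?thesis unfolding PE u_def[symmetric] using A B C by linarith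
    qed
    assume eq: "tail_const m * sylvester_rest k ^ (m + 2) = (\<Prod>i<n. b i) * (rest n / 3)"
    have "tail_const m * r ^ m * u\<^sup>2 = tail_const m * r ^ m * (P * r)"
      using A B C D eq unfolding PE u_def[symmetric] by linarith
    then have "u\<^sup>2 = P * r" using T ur by simp
    then have 1: "rest k = sylvester_rest k \<and> (\<forall>i<k. b i = 1 / real (sylvester (Suc i)))"
      using prod_rest_ge(2)[of k] Q d by (simp add: Q_def u_def r_def P_def)
    have "P * (tail_const m * r ^ (m + 1)) = P * E"
      using A B C D eq unfolding PE u_def[symmetric] by linarith
    then have "tail_const m * r ^ (m + 1) = E" using P by simp
    then show "rest k = sylvester_rest k \<and> (\<forall>i<k. b i = 1 / real (sylvester (Suc i))) \<and>
        (m = 1 \<longrightarrow> b k = rest k / 4)"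
      using 1 E by (auto simp: r_def)
  qed
qed

text \<open>The values \<open>tail_const m * sylvester_rest k ^ (m + 2)\<close> with
  \<open>k + m = n\<close> compete. For \<open>d = 3\<close> they are 1/12 and 1/16. For
  \<open>d = 4\<close> they are 1/108 and twice 1/128, but the one with \<open>m = 2\<close> is not
  attained, hence the second alternative in the case distinction. From \<open>d = 5\<close> on the
  empty tail wins.\<close>

lemma extremal_head:
  assumes d: "d = n + 2"
  shows "1 / real (max_mult d) \<le> (\<Prod>i<n. b i) * (rest n / 3)"
    and "1 / real (max_mult d) = (\<Prod>i<n. b i) * (rest n / 3) \<Longrightarrow>
      \<forall>i<n. b i = 1 / real (extremal_denominator d i)"
proof -
  obtain k m where km: "k + m = n"
    and ge: "tail_const m * sylvester_rest k ^ (m + 2) \<le> (\<Prod>i<n. b i) * (rest n / 3)"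
    and gt: "2 \<le> m \<Longrightarrow> tail_const m * sylvester_rest k ^ (m + 2) < (\<Prod>i<n. b i) * (rest n / 3)"
    and eq: "tail_const m * sylvester_rest k ^ (m + 2) = (\<Prod>i<n. b i) * (rest n / 3) \<Longrightarrow>
      rest k = sylvester_rest k \<and> (\<forall>i<k. b i = 1 / real (sylvester (Suc i))) \<and>
      (m = 1 \<longrightarrow> b k = rest k / 4)"
    using truncated_product_ge[OF d] by metis
  define c where "c = tail_const m * sylvester_rest k ^ (m + 2)"
  have t1: "sylvester_prod (Suc 0) = 2" "sylvester_prod (Suc (Suc 0)) = 6"
    by (simp_all add: sylvester_prod_Suc)
  then have u1: "sylvester_rest (Suc 0) = 1 / 2" "sylvester_rest (Suc (Suc 0)) = 1 / 6"
    by (simp_all add: sylvester_rest_def)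
  consider (0) "n = 0" | (1) "n = 1" | (2) "n = 2" | (3) "3 \<le> n" by linarith
  then have "1 / real (max_mult d) < c \<or> 2 \<le> m \<and> 1 / real (max_mult d) \<le> c \<or> 1 / real (max_mult d) = c \<and>
     (k = head_length d \<and> m = 0 \<or> k = head_length d \<and> m = 1)"
  proof cases
    case 0
    then show ?thesis using km d by (simp add: c_def max_mult_def head_length_def)
  next
    case 1
    then have "k = 0 \<and> m = 1 \<or> k = 1 \<and> m = 0" using km by auto
    then show ?thesis using 1 d by (auto simp: c_def max_mult_def head_length_def u1 power2_eq_square numeral_3_eq_3)
  next
    case 2
    then have "k = 0 \<and> m = 2 \<or> k = 1 \<and> m = 1 \<or> k = 2 \<and> m = 0" using km by auto
    then show ?thesis using 2 d
      by (auto simp: c_def max_mult_def head_length_def power2_eq_square numeral_2_eq_2 numeral_3_eq_3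
          u1 t1)
  next
    case 3
    then have hl: "head_length d = n" using d by (simp add: head_length_def)
    have mm: "1 / real (max_mult d) = sylvester_rest n ^ 2 / 3"
      using d hl by (simp add: max_mult_def sylvester_rest_def power2_eq_square)
    show ?thesis
    proof (cases "m = 0")
      case True
      then show ?thesis using km hl mm by (simp add: c_def power2_eq_square)
    next
      case False
      then show ?thesis using tail_const_sylvester_gt[OF km _ 3] mm by (simp add: c_def)
    qed
  qed
  then have main: "1 / real (max_mult d) \<le> c \<and> (1 / real (max_mult d) = (\<Prod>i<n. b i) * (rest n / 3) \<longrightarrow>
     c = (\<Prod>i<n. b i) * (rest n / 3) \<and> k = head_length d \<and> m \<le> 1)"
    using ge gt unfolding c_def[symmetric] by auto
  then show "1 / real (max_mult d) \<le> (\<Prod>i<n. b i) * (rest n / 3)"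
    using ge unfolding c_def[symmetric] by linarith
  assume "1 / real (max_mult d) = (\<Prod>i<n. b i) * (rest n / 3)"
  with main have k: "k = head_length d" "m \<le> 1" and ceq: "c = (\<Prod>i<n. b i) * (rest n / 3)"
    by blast+
  note eq = eq[OF ceq[unfolded c_def]]
  show "\<forall>i<n. b i = 1 / real (extremal_denominator d i)"
  proof (intro allI impI)
    fix i assume "i < n"
    show "b i = 1 / real (extremal_denominator d i)"
    proof (cases "i < k")
      case True
      then show ?thesis using eq k by (simp add: extremal_denominator_def)
    next
      case False
      then have "m = 1" "i = k" "d + 1 - k = 4" using k km d \<open>i < n\<close> by auto
      then show ?thesis using eq k(1)[symmetric]
        by (simp add: extremal_denominator_def sylvester_rest_def)
    qed
  qed
qed

text \<open>The last factor \<open>b (d - 2)\<close> is the largest of the last three terms, hence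
  at least a third of their sum. In the equality case these three coincide, and their value follows
  from the sum of all terms.\<close>

lemma prod_ge_inverse_max_mult:
  assumes "2 \<le> d"
  shows "1 / real (max_mult d) \<le> (\<Prod>i<d - 1. b i)"
    and "1 / real (max_mult d) = (\<Prod>i<d - 1. b i) \<Longrightarrow> i \<le> d \<Longrightarrow>
      b i = 1 / real (extremal_denominator d i)"
proof -
  obtain n where d: "d = n + 2" using assms by (metis add.commute le_iff_add)
  have rn: "rest n = b n + b (n + 1) + b (n + 2)"
    using rest_eq[of n] d by (simp add: sum.atLeast_Suc_atMost)
  have le: "b (n + 1) \<le> b n" "b (n + 2) \<le> b (n + 1)"
    using b_antimono d by auto
  have P: "0 < (\<Prod>i<n. b i)" using d by (intro prod_b_pos) auto
  have W: "(\<Prod>i<n. b i) * (rest n / 3) \<le> (\<Prod>i<d - 1. b i)"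
    using P le d rn by simp
  then show "1 / real (max_mult d) \<le> (\<Prod>i<d - 1. b i)"
    using extremal_head(1)[OF d] by linarith
  assume eq: "1 / real (max_mult d) = (\<Prod>i<d - 1. b i)" and i: "i \<le> d"
  have W1: "1 / real (max_mult d) = (\<Prod>i<n. b i) * (rest n / 3)"
    using W extremal_head(1)[OF d] eq by linarith
  then have head: "\<forall>i<n. b i = 1 / real (extremal_denominator d i)"
    by (rule extremal_head(2)[OF d])
  have "(\<Prod>i<n. b i) * (rest n / 3) = (\<Prod>i<n. b i) * b n"
    unfolding W1[symmetric] eq by (simp add: d)
  moreover have "(\<Prod>i<n. b i) \<noteq> 0" using P by (rule less_imp_neq[symmetric])
  ultimately have "rest n / 3 = b n" using mult_left_cancel by blast
  then have tail: "b j = rest n / 3" if "n \<le> j" "j \<le> d" for j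
  proof -
    have "j = n \<or> j = n + 1 \<or> j = n + 2" using that d by auto
    then show ?thesis using rn le \<open>rest n / 3 = b n\<close> by auto
  qed
  define k where "k = head_length d"
  have kn: "k \<le> n" using d by (auto simp: k_def head_length_def)
  have hd: "(\<Sum>i<k. b i) = (\<Sum>i<k. 1 / real (sylvester (Suc i)))"
    using head kn by (intro sum.cong) (auto simp: extremal_denominator_def k_def)
  have rk: "rest k = sylvester_rest k"
    unfolding rest_def hd sum_inverse_sylvester by simp
  define q where "q = 1 / real ((d + 1 - k) * sylvester_prod k)"
  have "(\<Sum>i=k..<n. b i) = (\<Sum>i=k..<n. q)"
    using head by (intro sum.cong) (auto simp: extremal_denominator_def k_def q_def)
  moreover have "rest k = (\<Sum>i=k..<n. b i) + rest n"
    unfolding rest_def using sum.atLeastLessThan_concat[of 0 k n b] kn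
    by (simp add: lessThan_atLeast0)
  moreover have "sylvester_rest k = real (d + 1 - k) * q"
    using kn d by (simp add: q_def sylvester_rest_def)
  ultimately have "rest n = real (d + 1 - k) * q - real (n - k) * q"
    using rk by simp
  also have "\<dots> = 3 * q"
    using kn d by (simp add: of_nat_diff algebra_simps)
  finally have "rest n / 3 = q" by simp
  moreover have "extremal_denominator d i = (d + 1 - k) * sylvester_prod k" if "n \<le> i" for i
    using kn that by (auto simp: extremal_denominator_def k_def)
  ultimately show "b i = 1 / real (extremal_denominator d i)"
    using head tail i by (cases "i < n") (auto simp: q_def)
qed

end


section \<open>Coordinates with respect to a simplex\<close>

text \<open>\<open>y i x\<close> is the barycentric coordinate of \<open>x\<close> at
  \<open>v i\<close> minus \<open>b i\<close>, that of the origin. The shift makes the coordinates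
  linear, with sum 0; the interior of the simplex is given by \<open>- b i < y i x\<close>.\<close>

locale simplex_coordinates =
  fixes v :: "nat \<Rightarrow> real ^ 'n::finite" and y :: "nat \<Rightarrow> real ^ 'n \<Rightarrow> real" and b :: "nat \<Rightarrow> real"
    and d :: nat
  assumes card_d: "CARD('n) = d"
    and y_linear: "linear (y i)"
    and y_vertex: "i \<le> d \<Longrightarrow> j \<le> d \<Longrightarrow> y i (v j) = of_bool (i = j) - b i"
    and y_repr: "(\<Sum>i\<le>d. y i x *\<^sub>R v i) = x"
    and y_sum: "(\<Sum>i\<le>d. y i x) = 0"
    and b_pos: "i \<le> d \<Longrightarrow> 0 < b i"
    and b_sum: "(\<Sum>i\<le>d. b i) = 1"
begin

definition vertex_hull :: "(real ^ 'n) set" where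
  "vertex_hull = convex hull (v ` {..d})"

lemma d_pos: "0 < d"
  using card_d by (metis zero_less_card_finite)

text \<open>Integral combinations of the vertices thus have as coordinates integer vectors plus
  integral multiples of \<open>b\<close>, the form in which the packing arguments use them.\<close>

lemma y_combination:
  assumes "i \<le> d"
  shows "y i (\<Sum>j\<le>d. c j *\<^sub>R v j) = c i - (\<Sum>j\<le>d. c j) * b i"
proof -
  interpret y: linear "y i" by (rule y_linear)
  have "y i (\<Sum>j\<le>d. c j *\<^sub>R v j) = (\<Sum>j\<le>d. c j * (of_bool (i = j) - b i))"
    using assms by (simp add: y.sum y.scaleR y_vertex)
  also have "\<dots> = (\<Sum>j\<le>d. c j * of_bool (i = j)) - (\<Sum>j\<le>d. c j) * b i"
    by (simp add: right_diff_distrib sum_subtractf sum_distrib_right)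
  also have "(\<Sum>j\<le>d. c j * of_bool (i = j)) = c i"
    using assms by (subst sum.remove[of _ i]) auto
  finally show ?thesis .
qed

lemma y_ext: "(\<And>i. i \<le> d \<Longrightarrow> y i x = y i x') \<Longrightarrow> x = x'"
  using y_repr[of x] y_repr[of x'] by (metis (no_types, lifting) atMost_iff sum.cong)

lemma y_0 [simp]: "y i 0 = 0"
  by (rule linear_0[OF y_linear])

lemma y_minus: "y i (- x) = - y i x"
  by (rule linear_neg[OF y_linear])

lemma y_add: "y i (x + z) = y i x + y i z"
  by (rule linear_add[OF y_linear])

lemma y_diff: "y i (x - z) = y i x - y i z"
  by (rule linear_diff[OF y_linear])

lemma y_scaleR: "y i (c *\<^sub>R x) = c * y i x"
  using linear_scale[OF y_linear] by simp

lemma y_last: "y d x = - (\<Sum>i<d. y i x)"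
  using y_sum[of x] by (simp add: lessThan_Suc_atMost[symmetric])

lemma y_eq_0_iff: "(\<forall>i<d. y i x = 0) \<longleftrightarrow> x = 0"
proof
  assume *: "\<forall>i<d. y i x = 0"
  then have "y d x = 0" by (simp add: y_last)
  then show "x = 0" using * y_ext[of x 0] by (auto simp: le_less)
qed simp

lemma sum_b_vertices: "(\<Sum>i\<le>d. b i *\<^sub>R v i) = 0"
  by (rule y_ext) (simp add: y_combination b_sum)

lemma b_less_1:
  assumes "i \<le> d"
  shows "b i < 1"
proof -
  obtain j where j: "j \<le> d" "j \<noteq> i"
    using d_pos that[of "if i = 0 then 1 else 0"] by (auto split: if_splits)
  have "b i + b j = (\<Sum>k\<in>{i, j}. b k)" using j by simp
  also have "\<dots> \<le> (\<Sum>k\<le>d. b k)"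
    using assms j b_pos by (intro sum_mono2) (auto intro: less_imp_le)
  finally show ?thesis using b_pos[OF j(1)] b_sum by simp
qed

lemma inj_on_v: "inj_on v {..d}"
proof (rule inj_onI, rule ccontr)
  fix i j assume "i \<in> {..d}" "j \<in> {..d}" "v i = v j" "i \<noteq> j"
  then show False using y_vertex[of i i] y_vertex[of i j] by simp
qed

lemma sum_image_v: "(\<Sum>x\<in>v ` {..d}. f x) = (\<Sum>i\<le>d. f (v i))"
  using sum.reindex[OF inj_on_v] by simp

lemma affine_independent_v: "\<not> affine_dependent (v ` {..d})"
proof
  assume "affine_dependent (v ` {..d})"
  then obtain u x where u: "sum u (v ` {..d}) = 0" "x \<in> v ` {..d}" "u x \<noteq> 0"
      "(\<Sum>w\<in>v ` {..d}. u w *\<^sub>R w) = 0"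
    by (auto simp: affine_dependent_explicit_finite)
  then obtain i where i: "i \<le> d" "x = v i" by auto
  have "y i (\<Sum>j\<le>d. u (v j) *\<^sub>R v j) = u (v i)"
    using y_combination[OF i(1), of "\<lambda>j. u (v j)"] u(1) by (simp add: sum_image_v)
  then show False using u i by (simp add: sum_image_v)
qed

lemma card_v: "card (v ` {..d}) = d + 1"
  using card_image[OF inj_on_v] by simp

lemma simplex_vertex_hull: "int CARD('n) simplex vertex_hull"
  unfolding vertex_hull_def simplex_def
  using affine_independent_v card_v card_d by (intro exI[of _ "v ` {..d}"]) auto

lemma vertices_vertex_hull: "vertices vertex_hull = v ` {..d}"
  using affine_independent_v
  by (auto simp: vertices_def vertex_hull_def extreme_point_of_convex_hull_affine_independent)

lemma interior_vertex_hull: "interior vertex_hull = {x. \<forall>i\<le>d. - b i < y i x}"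
proof -
  have "interior vertex_hull = {x. \<exists>u. (\<forall>w\<in>v ` {..d}. 0 < u w) \<and> sum u (v ` {..d}) = 1 \<and>
      (\<Sum>w\<in>v ` {..d}. u w *\<^sub>R w) = x}"
    unfolding vertex_hull_def using interior_convex_hull_explicit_minimal[OF affine_independent_v] card_v card_d by simp
  also have "\<dots> = {x. \<forall>i\<le>d. - b i < y i x}"
  proof (intro equalityI subsetI)
    fix x assume "x \<in> {x. \<exists>u. (\<forall>w\<in>v ` {..d}. 0 < u w) \<and> sum u (v ` {..d}) = 1 \<and>
      (\<Sum>w\<in>v ` {..d}. u w *\<^sub>R w) = x}"
    then obtain u where u: "\<And>i. i \<le> d \<Longrightarrow> 0 < u (v i)" "(\<Sum>i\<le>d. u (v i)) = 1"
        "x = (\<Sum>i\<le>d. u (v i) *\<^sub>R v i)"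
      by (auto simp: sum_image_v)
    then show "x \<in> {x. \<forall>i\<le>d. - b i < y i x}"
      using y_combination[of _ "\<lambda>i. u (v i)"] by simp
  next
    fix x assume x: "x \<in> {x. \<forall>i\<le>d. - b i < y i x}"
    define u where "u w = y (inv_into {..d} v w) x + b (inv_into {..d} v w)" for w
    have u: "u (v i) = y i x + b i" if "i \<le> d" for i
      using inv_into_f_f[OF inj_on_v, of i] that by (simp add: u_def)
    have "(\<Sum>i\<le>d. u (v i) *\<^sub>R v i) = (\<Sum>i\<le>d. y i x *\<^sub>R v i) + (\<Sum>i\<le>d. b i *\<^sub>R v i)"
      by (simp add: u scaleR_left_distrib sum.distrib)
    then have "(\<Sum>i\<le>d. u (v i) *\<^sub>R v i) = x"
      by (simp add: y_repr sum_b_vertices)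
    moreover have "(\<Sum>i\<le>d. u (v i)) = 1"
      by (simp add: u sum.distrib y_sum b_sum)
    moreover have "0 < u (v i)" if "i \<le> d" for i
    proof -
      have "- b i < y i x" using x that by blast
      then show ?thesis using u[OF that] by simp
    qed
    ultimately show "x \<in> {x. \<exists>u. (\<forall>w\<in>v ` {..d}. 0 < u w) \<and> sum u (v ` {..d}) = 1 \<and>
      (\<Sum>w\<in>v ` {..d}. u w *\<^sub>R w) = x}"
      by (intro CollectI exI[of _ u]) (auto simp: sum_image_v)
  qed
  finally show ?thesis .
qed

end

section \<open>The group of lattice points and the cosets of the vertex sublattice\<close>

lemma lattice_points_0 [simp]: "0 \<in> lattice_points"
  by (simp add: lattice_points_def)

lemma lattice_points_add: "x \<in> lattice_points \<Longrightarrow> z \<in> lattice_points \<Longrightarrow> x + z \<in> lattice_points"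
  by (simp add: lattice_points_def)

lemma lattice_points_diff: "x \<in> lattice_points \<Longrightarrow> z \<in> lattice_points \<Longrightarrow> x - z \<in> lattice_points"
  by (simp add: lattice_points_def)

lemma lattice_points_uminus: "x \<in> lattice_points \<Longrightarrow> - x \<in> lattice_points"
  by (simp add: lattice_points_def)

lemma lattice_points_int: "x \<in> lattice_points \<Longrightarrow> of_int k *\<^sub>R x \<in> lattice_points"
  by (simp add: lattice_points_def)

lemma lattice_points_sum:
  "(\<And>i. i \<in> A \<Longrightarrow> f i \<in> lattice_points) \<Longrightarrow> sum f A \<in> lattice_points"
  by (induction A rule: infinite_finite_induct) (auto intro: lattice_points_add)

lemma inv_lattice_group:
  fixes x :: "real ^ 'n"
  assumes "x \<in> lattice_points"
  shows "inv\<^bsub>lattice_group\<^esub> x = - x"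
proof -
  interpret L: comm_group "lattice_group :: (real ^ 'n) monoid" by (rule comm_group_lattice)
  show ?thesis
    using assms by (intro L.inv_equality) (auto simp: lattice_group_def lattice_points_uminus)
qed

lemma pow_lattice_group: "x [^]\<^bsub>lattice_group\<^esub> (n::nat) = real n *\<^sub>R x"
  by (induction n) (simp_all add: lattice_group_def nat_pow_def algebra_simps)

lemma generate_lattice_group:
  fixes v :: "nat \<Rightarrow> real ^ 'n"
  assumes "\<And>i. i \<le> m \<Longrightarrow> v i \<in> lattice_points"
  shows "generate lattice_group (v ` {..m}) = {x. \<exists>c. x = (\<Sum>i\<le>m. of_int (c i) *\<^sub>R v i)}"
    (is "?G = ?S")
proof
  interpret L: comm_group "lattice_group :: (real ^ 'n) monoid" by (rule comm_group_lattice)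
  have sub: "v ` {..m} \<subseteq> carrier lattice_group" using assms by (auto simp: lattice_group_def)
  interpret G: subgroup ?G lattice_group by (rule L.generate_is_subgroup[OF sub])
  have add: "x + z \<in> ?G" if "x \<in> ?G" "z \<in> ?G" for x z
    using G.m_closed[OF that] by (simp add: lattice_group_def)
  have zero: "0 \<in> ?G" using G.one_closed by (simp add: lattice_group_def)
  have minus: "- x \<in> ?G" if "x \<in> ?G" for x
    using G.m_inv_closed[OF that] inv_lattice_group[of x] G.subset that by (auto simp: lattice_group_def)
  have nat: "real k *\<^sub>R x \<in> ?G" if "x \<in> ?G" for k x
    by (induction k) (auto simp: zero add that algebra_simps)
  have int: "of_int k *\<^sub>R x \<in> ?G" if "x \<in> ?G" for k :: int and x
    using nat[OF that] minus[OF nat[OF that]] by (cases k) (simp_all del: of_nat_Suc)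
  have "(\<Sum>i\<in>A. of_int (c i) *\<^sub>R v i) \<in> ?G" if "A \<subseteq> {..m}" for A c
    using finite_subset[OF that] that
    by (induction A rule: finite_induct) (auto intro!: add zero int intro: generate.incl)
  then show "?S \<subseteq> ?G" by auto
  show "?G \<subseteq> ?S"
  proof
    fix x assume "x \<in> ?G"
    then show "x \<in> ?S"
    proof (induction rule: generate.induct)
      case one
      show ?case by (auto simp: lattice_group_def intro!: exI[of _ "\<lambda>_. 0"])
    next
      case (incl h)
      then obtain i where i: "i \<le> m" "h = v i" by auto
      have "(\<Sum>j\<le>m. of_int (of_bool (j = i)) *\<^sub>R v j) = v i"
        using i by (subst sum.remove[of _ i]) auto
      then show ?case using i by (intro CollectI exI[of _ "\<lambda>j. of_bool (j = i)"]) simp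
    next
      case (inv h)
      then obtain i where i: "i \<le> m" "h = v i" by auto
      have "(\<Sum>j\<le>m. of_int (- of_bool (j = i)) *\<^sub>R v j) = - v i"
        using i by (subst sum.remove[of _ i]) auto
      then show ?case using i inv_lattice_group[OF assms[OF i(1)]]
        by (intro CollectI exI[of _ "\<lambda>j. - of_bool (j = i)"]) simp
    next
      case (eng h1 h2)
      then obtain c1 c2 where "h1 = (\<Sum>i\<le>m. of_int (c1 i) *\<^sub>R v i)" "h2 = (\<Sum>i\<le>m. of_int (c2 i) *\<^sub>R v i)"
        by auto
      then show ?case
        by (intro CollectI exI[of _ "\<lambda>j. c1 j + c2 j"])
          (simp add: lattice_group_def scaleR_left_distrib sum.distrib)
    qed
  qed
qed

lemma subgroup_vertex_sublattice:
  assumes "fano_simplex P"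
  shows "subgroup (vertex_sublattice P) lattice_group"
proof -
  interpret L: comm_group "lattice_group :: (real ^ 'n) monoid" by (rule comm_group_lattice)
  have "vertices P \<subseteq> carrier lattice_group"
    using assms by (auto simp: fano_simplex_def primitive_point_def lattice_group_def)
  then show ?thesis unfolding vertex_sublattice_def by (rule L.generate_is_subgroup)
qed

lemma multiplicity_pos:
  assumes "fano_simplex P"
  shows "0 < fwps_multiplicity P"
proof -
  interpret L: comm_group "lattice_group :: (real ^ 'n) monoid" by (rule comm_group_lattice)
  interpret Q: group "quotient_group P"
    unfolding quotient_group_def
    using normal.factorgroup_is_group[OF L.subgroup_imp_normal[OF subgroup_vertex_sublattice[OF assms]]] .
  show ?thesis
    using finite_quotient_group[OF assms] Q.one_closed
    by (auto simp: fwps_multiplicity_def order_def card_gt_0_iff)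
qed

lemma lattice_coset_eq_iff:
  assumes "fano_simplex P" "x \<in> lattice_points" "z \<in> lattice_points"
  shows "vertex_sublattice P #>\<^bsub>lattice_group\<^esub> x = vertex_sublattice P #>\<^bsub>lattice_group\<^esub> z
    \<longleftrightarrow> x - z \<in> vertex_sublattice P"
proof -
  interpret L: comm_group "lattice_group :: (real ^ 'n) monoid" by (rule comm_group_lattice)
  note H = subgroup_vertex_sublattice[OF assms(1)]
  have xz: "x \<in> carrier lattice_group" "z \<in> carrier lattice_group"
    using assms by (simp_all add: lattice_group_def)
  have "x - z \<in> vertex_sublattice P \<longleftrightarrow> x \<in> vertex_sublattice P #>\<^bsub>lattice_group\<^esub> z"
  proof
    assume "x - z \<in> vertex_sublattice P"
    then show "x \<in> vertex_sublattice P #>\<^bsub>lattice_group\<^esub> z"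
      by (auto simp: r_coset_def lattice_group_def intro!: bexI[of _ "x - z"])
  qed (auto simp: r_coset_def lattice_group_def)
  also have "\<dots> \<longleftrightarrow> vertex_sublattice P #>\<^bsub>lattice_group\<^esub> x = vertex_sublattice P #>\<^bsub>lattice_group\<^esub> z"
    using L.repr_independence[OF _ xz(2) H, of x] L.rcos_self[OF xz(1) H] by auto
  finally show ?thesis by simp
qed

text \<open>A transversal makes the multiplicity the size of a set of lattice points, which is what
  the counting arguments work with.\<close>

lemma coset_representatives:
  fixes P :: "(real ^ 'n::finite) set"
  assumes "fano_simplex P"
  obtains X where "X \<subseteq> lattice_points" "finite X" "card X = fwps_multiplicity P"
    and "\<And>x. x \<in> lattice_points \<Longrightarrow> \<exists>r\<in>X. x - r \<in> vertex_sublattice P"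
    and "\<And>r r'. r \<in> X \<Longrightarrow> r' \<in> X \<Longrightarrow> r - r' \<in> vertex_sublattice P \<Longrightarrow> r = r'"
proof -
  define H where "H = vertex_sublattice P"
  define co where "co x = H #>\<^bsub>lattice_group\<^esub> x" for x
  have car: "carrier (quotient_group P) = co ` lattice_points"
    by (auto simp: quotient_group_def FactGroup_def RCOSETS_def H_def co_def lattice_group_def)
  then obtain X where X: "X \<subseteq> lattice_points" "inj_on co X" "carrier (quotient_group P) = co ` X"
    by (metis subset_image_inj subset_refl)
  show ?thesis
  proof (rule that[OF X(1)])
    show "finite X"
      using finite_quotient_group[OF assms] X by (simp add: finite_image_iff)
    show "card X = fwps_multiplicity P"
      using card_image[OF X(2)] X(3) by (simp add: fwps_multiplicity_def order_def)
    show "\<exists>r\<in>X. x - r \<in> vertex_sublattice P" if "x \<in> lattice_points" for x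
    proof -
      have "co x \<in> co ` X" using that car X(3) by blast
      then obtain r where "r \<in> X" "co x = co r" by blast
      then show ?thesis
        using lattice_coset_eq_iff[OF assms that, of r] X(1) by (auto simp: co_def H_def)
    qed
    show "r = r'" if "r \<in> X" "r' \<in> X" "r - r' \<in> vertex_sublattice P" for r r'
      using that X lattice_coset_eq_iff[OF assms, of r r'] by (auto simp: co_def H_def inj_on_def)
  qed
qed

text \<open>Lagrange's theorem in the quotient group. It bounds the denominators of the coordinates
  of lattice points.\<close>

lemma multiplicity_scaleR_mem:
  fixes x :: "real ^ 'n::finite"
  assumes "fano_simplex P" "x \<in> lattice_points"
  shows "real (fwps_multiplicity P) *\<^sub>R x \<in> vertex_sublattice P"
proof -
  interpret L: comm_group "lattice_group :: (real ^ 'n) monoid" by (rule comm_group_lattice)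
  note H = subgroup_vertex_sublattice[OF assms(1)]
  have N: "vertex_sublattice P \<lhd> lattice_group" by (rule L.subgroup_imp_normal[OF H])
  interpret Q: group "quotient_group P"
    unfolding quotient_group_def using normal.factorgroup_is_group[OF N] .
  define co where "co x = vertex_sublattice P #>\<^bsub>lattice_group\<^esub> x" for x
  have hom: "co \<in> hom lattice_group (quotient_group P)"
    unfolding co_def quotient_group_def using normal.r_coset_hom_Mod[OF N] .
  interpret h: group_hom lattice_group "quotient_group P" co
    by (rule group_hom.intro[OF L.group_axioms Q.group_axioms]) (simp add: group_hom_axioms_def hom)
  have x: "x \<in> carrier lattice_group" using assms(2) by (simp add: lattice_group_def)
  let ?m = "fwps_multiplicity P"
  have "co (x [^]\<^bsub>lattice_group\<^esub> ?m) = co x [^]\<^bsub>quotient_group P\<^esub> ?m"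
    using h.hom_nat_pow[OF x] .
  also have "\<dots> = \<one>\<^bsub>quotient_group P\<^esub>"
    unfolding fwps_multiplicity_def using h.hom_closed[OF x] by (rule Q.pow_order_eq_1)
  also have "\<dots> = co 0"
    using h.hom_one by (simp add: lattice_group_def)
  finally have "co (real ?m *\<^sub>R x) = co 0" by (simp add: pow_lattice_group)
  then show ?thesis
    using lattice_coset_eq_iff[OF assms(1), of "real ?m *\<^sub>R x" 0] lattice_points_int[OF assms(2), of "int ?m"]
    by (simp add: co_def)
qed


section \<open>Packing arguments\<close>

locale canonical_simplex = simplex_coordinates v y b d
  for v :: "nat \<Rightarrow> real ^ 'n::finite" and y :: "nat \<Rightarrow> real ^ 'n \<Rightarrow> real" and b :: "nat \<Rightarrow> real" and d :: nat +
  fixes lam :: "nat \<Rightarrow> nat" and h :: nat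
  assumes v_lattice: "i \<le> d \<Longrightarrow> v i \<in> lattice_points"
    and h_eq: "h = (\<Sum>i\<le>d. lam i)"
    and b_eq: "b i = real (lam i) / real h"
    and Gcd_lam: "Gcd (lam ` {..d}) = 1"
    and canonical: "x \<in> lattice_points \<Longrightarrow> (\<And>i. i \<le> d \<Longrightarrow> - b i < y i x) \<Longrightarrow> x = 0"
begin

lemma h_pos: "0 < h"
  using b_pos[of 0] b_eq[of 0] by (cases h) auto

lemma lam_pos: "i \<le> d \<Longrightarrow> 0 < lam i"
  using b_pos[of i] b_eq[of i] by (cases "lam i") auto

lemma interior_lattice_points: "interior vertex_hull \<inter> lattice_points = {0}"
proof (intro equalityI subsetI)
  fix x assume "x \<in> interior vertex_hull \<inter> lattice_points"
  then show "x \<in> {0}" using canonical[of x] by (simp add: interior_vertex_hull)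
qed (simp add: interior_vertex_hull b_pos)

text \<open>If \<open>v i\<close> were \<open>k\<close> times a lattice point with
  \<open>2 \<le> k\<close>, that point would lie strictly between the origin and \<open>v i\<close>,
  hence in the interior.\<close>

lemma primitive_v:
  assumes "i \<le> d"
  shows "primitive_point (v i)"
  unfolding primitive_point_def
proof (intro conjI ballI allI impI)
  show "v i \<in> lattice_points" using assms by (rule v_lattice)
  fix u k assume u: "u \<in> lattice_points" "v i = real k *\<^sub>R u"
  have nz: "v i \<noteq> 0" using y_vertex[of i i] b_less_1[of i] assms by auto
  then have "k \<noteq> 0" using u by auto
  show "k = 1"
  proof (rule ccontr)
    assume "k \<noteq> 1"
    then have k: "2 \<le> real k" using \<open>k \<noteq> 0\<close> by simp
    have "- b j < y j u" if j: "j \<le> d" for j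
    proof -
      have "real k * y j u = of_bool (j = i) - b j"
        using y_vertex[of j i] assms j u(2) y_scaleR[of j "real k" u] by simp
      moreover have "b j < real k * b j"
        using mult_strict_right_mono[of 1 "real k" "b j"] b_pos[OF j] k by simp
      ultimately have "real k * (- b j) < real k * y j u" by (cases "j = i") simp_all
      then show ?thesis using mult_less_cancel_left_pos[of "real k" "- b j" "y j u"] k by linarith
    qed
    then have "u = 0" using u by (intro canonical) auto
    then show False using nz u by simp
  qed
qed

lemma fano_simplex_vertex_hull: "fano_simplex vertex_hull"
  using simplex_vertex_hull primitive_v interior_lattice_points
  unfolding fano_simplex_def vertices_vertex_hull by blast

lemma canonical_fano_simplex_vertex_hull: "canonical_fano_simplex vertex_hull"
  using fano_simplex_vertex_hull interior_lattice_points by (simp add: canonical_fano_simplex_def)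

lemma vertex_sublattice_vertex_hull:
  "vertex_sublattice vertex_hull = {x. \<exists>c. x = (\<Sum>i\<le>d. of_int (c i) *\<^sub>R v i)}"
  unfolding vertex_sublattice_def vertices_vertex_hull
  by (rule generate_lattice_group) (rule v_lattice)

definition lattice_index :: nat where
  "lattice_index = fwps_multiplicity vertex_hull"

lemma lattice_index_pos: "0 < lattice_index"
  unfolding lattice_index_def by (rule multiplicity_pos[OF fano_simplex_vertex_hull])

lemma small_lattice_point:
  assumes "x \<in> lattice_points"
    and "\<And>i. i \<le> d \<Longrightarrow> i \<noteq> j \<Longrightarrow> \<bar>y i x\<bar> < b i"
    and "j \<le> d"
  shows "x = 0"
proof (cases "0 \<le> y j x")
  case True
  show ?thesis
  proof (rule canonical[OF assms(1)])
    fix i assume i: "i \<le> d"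
    show "- b i < y i x"
      using assms(2)[OF i] True b_pos[OF i] by (cases "i = j") auto
  qed
next
  case False
  have "- x = 0"
  proof (rule canonical[OF lattice_points_uminus[OF assms(1)]])
    fix i assume i: "i \<le> d"
    show "- b i < y i (- x)"
      using assms(2)[OF i] False b_pos[OF i] by (cases "i = j") (auto simp: y_minus)
  qed
  then show ?thesis by simp
qed

lemma combination_lattice: "(\<Sum>i\<le>d. of_int (c i) *\<^sub>R v i) \<in> lattice_points"
  by (intro lattice_points_sum lattice_points_int v_lattice) auto

text \<open>
  Minkowski's argument inside the span of the first \<open>j\<close> vertices, carried out by counting: modulo
  the sublattice these vertices generate, scaled by \<open>h\<close>, every integer vector is congruent to one
  whose first \<open>j - 1\<close> entries are residues modulo \<open>h\<close> and whose sum is a residue modulo \<open>s\<close>.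
\<close>

lemma prod_weights_le:
  assumes "j < d"
  shows "(\<Prod>i<Suc j. lam i) \<le> h ^ j * (\<Sum>i=Suc j..d. lam i)"
proof -
  define s where "s = (\<Sum>i=Suc j..d. lam i)"
  have "{..d} = {..<Suc j} \<union> {Suc j..d}" using assms by auto
  then have hs: "h = (\<Sum>i<Suc j. lam i) + s"
    unfolding h_eq s_def by (simp add: sum.union_disjoint ivl_disj_int del: sum.lessThan_Suc)
  have s: "0 < s" unfolding s_def using assms lam_pos by (intro sum_pos) auto
  define Z where "Z z = (\<Sum>i<Suc j. z i)" for z :: "nat \<Rightarrow> nat"
  \<comment> \<open>A combination of the first \<open>Suc j\<close> vertices with coefficient sum
    \<open>k\<close> has, scaled by \<open>h\<close>, the entries \<open>- k * lam i\<close> modulo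
    \<open>h\<close> and the total \<open>k * s\<close> over these entries. Subtracting one with
    \<open>k = Z z div s\<close> leaves the total \<open>Z z mod s\<close>; entry \<open>j\<close>
    is determined modulo \<open>h\<close> by this total and the other entries, and is left
    out.\<close>
  define F where "F z = ((\<lambda>i\<in>{..<j}. (z i + Z z div s * lam i) mod h), Z z mod s)" for z
  define B where "B = PiE {..<Suc j} (\<lambda>i. {..<lam i})"
  define T where "T = PiE {..<j} (\<lambda>_. {..<h}) \<times> {..<s}"
  have "inj_on F B"
  proof (rule inj_onI)
    fix z z' assume z: "z \<in> B" "z' \<in> B" and F: "F z = F z'"
    define w where "w i = int (z i) - int (z' i)" for i
    define del where "del = int (Z z div s) - int (Z z' div s)"
    have "\<exists>n. w i + del * int (lam i) = int h * n" if "i < j" for i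
    proof -
      have "(z i + Z z div s * lam i) mod h = (z' i + Z z' div s * lam i) mod h"
        using fun_cong[OF arg_cong[OF F, of fst], of i] that by (simp add: F_def)
      then have "int h dvd int (z i + Z z div s * lam i) - int (z' i + Z z' div s * lam i)"
        by (metis mod_eq_dvd_iff zmod_int)
      then show ?thesis by (simp add: dvd_def w_def del_def algebra_simps)
    qed
    then obtain n where n: "\<And>i. i < j \<Longrightarrow> w i + del * int (lam i) = int h * n i" by metis
    have "(\<Sum>i<Suc j. w i) = int (Z z) - int (Z z')"
      by (simp add: w_def Z_def sum_subtractf)
    also have "\<dots> = int s * del"
    proof -
      have "Z z mod s = Z z' mod s" using arg_cong[OF F, of snd] by (simp add: F_def)
      moreover have "int (Z z) = int s * int (Z z div s) + int (Z z mod s)"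
        "int (Z z') = int s * int (Z z' div s) + int (Z z' mod s)"
        by (simp_all flip: of_nat_mult of_nat_add)
      ultimately show ?thesis by (simp add: del_def algebra_simps)
    qed
    finally have wsum: "(\<Sum>i<j. w i) + w j = int s * del" by simp
    have "(\<Sum>i<j. w i) + del * (\<Sum>i<j. int (lam i)) = int h * (\<Sum>i<j. n i)"
      using n by (simp add: sum_distrib_left flip: sum.distrib)
    moreover have "int h = (\<Sum>i<j. int (lam i)) + int (lam j) + int s"
      by (simp add: hs)
    ultimately have last: "w j + del * int (lam j) = int h * (del - (\<Sum>i<j. n i))"
      using wsum by (simp add: algebra_simps)
    define c where "c i = (if i < j then n i else if i = j then del - (\<Sum>i<j. n i) else 0)" for i
    have c_eq: "w i + del * int (lam i) = int h * c i" if "i \<le> j" for i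
      using n last that by (cases "i = j") (auto simp: c_def)
    have csum: "(\<Sum>i\<le>d. c i) = del"
    proof -
      have "(\<Sum>i\<le>d. c i) = (\<Sum>i<Suc j. c i)"
        using assms by (intro sum.mono_neutral_right) (auto simp: c_def)
      also have "\<dots> = del" by (simp add: c_def)
      finally show ?thesis .
    qed
    define x where "x = (\<Sum>i\<le>d. of_int (c i) *\<^sub>R v i)"
    have x: "x \<in> lattice_points" unfolding x_def by (rule combination_lattice)
    have yx: "y i x = of_int (c i) - of_int del * b i" if "i \<le> d" for i
      using y_combination[OF that, of "\<lambda>i. of_int (c i)"]
      by (simp add: x_def flip: csum)
    have yw: "y i x = of_int (w i) / real h" if "i \<le> j" for i
    proof -
      have "of_int (w i) + of_int del * real (lam i) = real h * of_int (c i)"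
        using arg_cong[OF c_eq[OF that], of real_of_int] by simp
      then show ?thesis using yx[of i] that assms h_pos by (simp add: b_eq field_simps)
    qed
    have small: "\<bar>y i x\<bar> < b i" if "i \<le> j" for i
    proof -
      have "z i < lam i" "z' i < lam i"
        using PiE_mem[OF z(1)[unfolded B_def], of i] PiE_mem[OF z(2)[unfolded B_def], of i] that by simp_all
      then have "\<bar>w i\<bar> < int (lam i)" unfolding w_def by linarith
      then have "real_of_int \<bar>w i\<bar> < real_of_int (int (lam i))" by (simp only: of_int_less_iff)
      then have "\<bar>real_of_int (w i)\<bar> / real h < real (lam i) / real h"
        using h_pos by (intro divide_strict_right_mono) auto
      then show ?thesis unfolding yw[OF that] b_eq by (simp add: abs_divide)
    qed
    \<comment> \<open>All coordinates after \<open>j\<close> have the sign of \<open>- del\<close>,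
      so \<open>x\<close> or \<open>- x\<close> satisfies the inequalities of the interior, however
      large \<open>del\<close> is.\<close>
    have tail: "y i x = - of_int del * b i" if "j < i" "i \<le> d" for i
      using yx[OF that(2)] that(1) by (simp add: c_def)
    have "x = 0"
    proof (cases "del \<le> 0")
      case True
      show ?thesis
      proof (rule canonical[OF x])
        fix i assume i: "i \<le> d"
        have "0 \<le> - of_int del * b i" using True b_pos[OF i] by (simp add: mult_nonpos_nonneg)
        show "- b i < y i x"
        proof (cases "i \<le> j")
          case True
          then show ?thesis using small[of i] by linarith
        next
          case False
          then have "y i x = - of_int del * b i" using tail i by simp
          then show ?thesis using b_pos[OF i] \<open>0 \<le> - of_int del * b i\<close> by linarith
        qed
      qed
    next
      case False
      have "- x = 0"
      proof (rule canonical[OF lattice_points_uminus[OF x]])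
        fix i assume i: "i \<le> d"
        have "0 \<le> of_int del * b i" using False b_pos[OF i] by simp
        show "- b i < y i (- x)"
        proof (cases "i \<le> j")
          case True
          then show ?thesis using small[of i] unfolding y_minus by linarith
        next
          case False
          then have "y i x = - (of_int del * b i)" using tail i by simp
          then show ?thesis using b_pos[OF i] \<open>0 \<le> of_int del * b i\<close> unfolding y_minus by linarith
        qed
      qed
      then show ?thesis by simp
    qed
    then have "w i = 0" if "i \<le> j" for i
      using yw[OF that] h_pos by simp
    then have "z i = z' i" if "i \<le> j" for i
      using that unfolding w_def by force
    then show "z = z'"
      by (intro PiE_ext[OF z[unfolded B_def]]) simp
  qed
  moreover have "F ` B \<subseteq> T"
    unfolding F_def T_def image_subset_iff mem_Times_iff fst_conv snd_conv restrict_PiE_iff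
    using h_pos s by simp
  moreover have "finite T" by (simp add: T_def finite_PiE)
  ultimately have "card B \<le> card T" by (intro card_inj_on_le)
  then show ?thesis by (simp add: B_def T_def card_PiE card_cartesian_product s_def)
qed

lemma scaled_y_integral:
  assumes "x \<in> lattice_points" "i \<le> d"
  shows "real (lattice_index * h) * y i x \<in> \<int>"
proof -
  have "real lattice_index *\<^sub>R x \<in> vertex_sublattice vertex_hull"
    unfolding lattice_index_def by (rule multiplicity_scaleR_mem[OF fano_simplex_vertex_hull assms(1)])
  then obtain c where c: "real lattice_index *\<^sub>R x = (\<Sum>i\<le>d. of_int (c i) *\<^sub>R v i)"
    by (auto simp: vertex_sublattice_vertex_hull)
  have "real lattice_index * y i x = of_int (c i) - of_int (\<Sum>j\<le>d. c j) * b i"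
    using y_combination[OF assms(2), of "\<lambda>i. of_int (c i)"] y_scaleR[of i "real lattice_index" x] c by simp
  then have "real (lattice_index * h) * y i x = of_int (int h * c i - (\<Sum>j\<le>d. c j) * int (lam i))"
    using h_pos by (simp add: b_eq field_simps)
  then show ?thesis by (metis Ints_of_int)
qed

text \<open>Since the weights are coprime, \<open>b\<close> has order exactly \<open>h\<close>
  modulo integer vectors. This keeps the \<open>h\<close> multiples of \<open>b\<close> in the count
  below apart.\<close>

lemma dvd_weights_imp_dvd:
  assumes "\<And>i. i \<le> d \<Longrightarrow> int h dvd k * int (lam i)"
  shows "int h dvd k"
proof -
  have "h dvd nat \<bar>k\<bar> * g" if g: "g \<in> lam ` {..d}" for g
  proof -
    obtain i where i: "i \<le> d" "g = lam i" using g by blast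
    have "int h dvd \<bar>k * int (lam i)\<bar>" using assms[OF i(1)] by simp
    then show ?thesis using i(2) by (simp add: abs_mult flip: int_dvd_int_iff)
  qed
  then have "h dvd Gcd ((*) (nat \<bar>k\<bar>) ` (lam ` {..d}))"
    by (intro Gcd_greatest) auto
  also have "Gcd ((*) (nat \<bar>k\<bar>) ` (lam ` {..d})) = nat \<bar>k\<bar>"
    by (subst Gcd_mult) (simp add: Gcd_lam)
  finally show ?thesis by (metis abs_dvd_iff dvd_abs_iff int_dvd_int_iff nat_0_le abs_ge_zero)
qed

text \<open>The factor is a common denominator of the coordinates of lattice points, so on these the
  floor only changes the type.\<close>

definition scaled_y :: "nat \<Rightarrow> real ^ 'n \<Rightarrow> int" where
  "scaled_y i x = \<lfloor>real (lattice_index * h) * y i x\<rfloor>"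

lemma of_int_scaled_y:
  "x \<in> lattice_points \<Longrightarrow> i \<le> d \<Longrightarrow> of_int (scaled_y i x) = real (lattice_index * h) * y i x"
  using Ints_cases[OF scaled_y_integral[of x i]] by (metis scaled_y_def floor_of_int)

lemma scaled_b: "real (lattice_index * h) * b i = real (lattice_index * lam i)"
  unfolding b_eq of_nat_mult using h_pos by simp

text \<open>
  Minkowski's argument for the whole lattice in the first \<open>d\<close> coordinates, again by counting:
  the translates of a box are disjoint modulo \<open>lattice_index * h\<close>.  The index \<open>k\<close> runs over the multiples
  of the origin's barycentric coordinates.
\<close>

definition box_translate :: "(real ^ 'n) \<times> nat \<times> (nat \<Rightarrow> nat) \<Rightarrow> nat \<Rightarrow> int" where
  "box_translate = (\<lambda>(r, k, z). \<lambda>i\<in>{..<d}. (int (z i) + scaled_y i r + int k * int (lattice_index * lam i)) mod int (lattice_index * h))"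

text \<open>The coefficient of \<open>v d\<close> enters the first \<open>d\<close> coordinates only
  through the coefficient sum, so it can be used to prescribe that sum. In these coordinates the
  vertex sublattice consists of the integer vectors plus multiples of \<open>b\<close>.\<close>

lemma combination_with_sum:
  fixes n :: "nat \<Rightarrow> int" and k :: int
  obtains x where "x \<in> vertex_sublattice vertex_hull" "x \<in> lattice_points"
    and "\<And>i. i < d \<Longrightarrow> y i x = of_int (n i) - of_int k * b i"
proof -
  define c where "c i = (if i < d then n i else k - (\<Sum>i<d. n i))" for i
  have "(\<Sum>i\<le>d. c i) = (\<Sum>i<d. c i) + c d"
    by (simp add: lessThan_Suc_atMost[symmetric])
  also have "\<dots> = k" by (simp add: c_def)
  finally have c: "(\<Sum>i\<le>d. c i) = k" .
  have "y i (\<Sum>i\<le>d. of_int (c i) *\<^sub>R v i) = of_int (n i) - of_int k * b i" if "i < d" for i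
    using y_combination[of i "\<lambda>i. of_int (c i)"] that
    by (simp add: c[symmetric]) (simp add: c_def)
  then show ?thesis
    using combination_lattice[of c] by (intro that) (auto simp: vertex_sublattice_vertex_hull)
qed

text \<open>A coincidence of residues yields a lattice point whose scaled coordinates are
  \<open>z' i - z i\<close>; only the last coordinate is uncontrolled, so the point is the origin.
  Hence \<open>z = z'\<close>, both representatives lie in one coset, and coprimality of the weights
  gives \<open>k = k'\<close>.\<close>

lemma inj_on_box_translate:
  assumes X: "X \<subseteq> lattice_points"
    and X_inj: "\<And>r r'. r \<in> X \<Longrightarrow> r' \<in> X \<Longrightarrow> r - r' \<in> vertex_sublattice vertex_hull \<Longrightarrow> r = r'"
  shows "inj_on box_translate (X \<times> {..<h} \<times> PiE {..<d} (\<lambda>i. {..<lattice_index * lam i}))"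
proof (rule inj_onI)
  fix p p'
  assume p: "p \<in> X \<times> {..<h} \<times> PiE {..<d} (\<lambda>i. {..<lattice_index * lam i})"
    and p': "p' \<in> X \<times> {..<h} \<times> PiE {..<d} (\<lambda>i. {..<lattice_index * lam i})"
    and pp': "box_translate p = box_translate p'"
  obtain r k z r' k' z' where pe: "p = (r, k, z)" "p' = (r', k', z')"
    by (metis prod_cases3)
  have r: "r \<in> X" "r' \<in> X" and k: "k < h" "k' < h"
    and z: "z \<in> PiE {..<d} (\<lambda>i. {..<lattice_index * lam i})" "z' \<in> PiE {..<d} (\<lambda>i. {..<lattice_index * lam i})"
    using p p' unfolding pe by blast+
  have eq: "box_translate (r, k, z) = box_translate (r', k', z')"
    using pp' by (simp only: pe)
  define Q where "Q = lattice_index * h"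
  have Q: "0 < real Q" unfolding Q_def using lattice_index_pos h_pos by simp
  define del where "del = int k - int k'"
  have "\<exists>n. int (z i) - int (z' i) + scaled_y i r - scaled_y i r' + del * int (lattice_index * lam i) = int Q * n"
    if "i < d" for i
  proof -
    have "(int (z i) + scaled_y i r + int k * int (lattice_index * lam i)) mod int Q
        = (int (z' i) + scaled_y i r' + int k' * int (lattice_index * lam i)) mod int Q"
      using fun_cong[OF eq, of i] that by (simp add: box_translate_def Q_def)
    then have "int Q dvd (int (z i) + scaled_y i r + int k * int (lattice_index * lam i))
        - (int (z' i) + scaled_y i r' + int k' * int (lattice_index * lam i))"
      by (simp add: mod_eq_dvd_iff)
    then show ?thesis by (auto simp: dvd_def del_def algebra_simps)
  qed
  then obtain n where n: "\<And>i. i < d \<Longrightarrow>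
      int (z i) - int (z' i) + scaled_y i r - scaled_y i r' + del * int (lattice_index * lam i) = int Q * n i"
    by metis
  obtain x' where x': "x' \<in> vertex_sublattice vertex_hull" "x' \<in> lattice_points"
      "\<And>i. i < d \<Longrightarrow> y i x' = of_int (n i) - of_int del * b i"
    using combination_with_sum[of n del] by blast
  define x where "x = r - r' - x'"
  have x: "x \<in> lattice_points"
    unfolding x_def using r X x' by (intro lattice_points_diff) auto
  have yx: "real Q * y i x = real (z' i) - real (z i)" if "i < d" for i
  proof -
    have 1: "real Q * y i r = of_int (scaled_y i r)" "real Q * y i r' = of_int (scaled_y i r')"
      using of_int_scaled_y[of r i] of_int_scaled_y[of r' i] r X that by (auto simp: Q_def)
    have 2: "real Q * b i = real (lattice_index * lam i)" unfolding Q_def by (rule scaled_b)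
    have "real (z i) - real (z' i) + of_int (scaled_y i r) - of_int (scaled_y i r')
        + of_int del * real (lattice_index * lam i) = real Q * of_int (n i)"
      using arg_cong[OF n[OF that], of real_of_int] by simp
    then show ?thesis
      unfolding x_def y_diff x'(3)[OF that] right_diff_distrib 1 using 2
      by (simp add: algebra_simps)
  qed
  have "x = 0"
  proof (rule small_lattice_point[OF x, of d])
    fix i assume i: "i \<le> d" "i \<noteq> d"
    then have "i < d" by simp
    then have "z i < lattice_index * lam i" "z' i < lattice_index * lam i"
      using PiE_mem[OF z(1), of i] PiE_mem[OF z(2), of i] by simp_all
    then have "real (z i) < real (lattice_index * lam i)" "real (z' i) < real (lattice_index * lam i)"
      by (simp_all only: of_nat_less_iff)
    then have "\<bar>real Q * y i x\<bar> < real Q * b i"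
      unfolding yx[OF \<open>i < d\<close>] unfolding Q_def scaled_b by linarith
    then show "\<bar>y i x\<bar> < b i" using Q by (simp add: abs_mult)
  qed simp
  then have zz: "z i = z' i" if "i < d" for i
    using yx[OF that] by simp
  then have "z = z'"
    by (intro PiE_ext[OF z]) simp
  have "r - r' = x'" using \<open>x = 0\<close> by (simp add: x_def)
  then have "r = r'" using X_inj r x'(1) by metis
  have dvd: "int h dvd del * int (lam i)" if "i < d" for i
  proof -
    have "int lattice_index * (del * int (lam i)) = int lattice_index * (int h * n i)"
      using n[OF that] zz[OF that] \<open>r = r'\<close> by (simp add: Q_def algebra_simps)
    then show ?thesis using lattice_index_pos by simp
  qed
  have "int h dvd del"
  proof (rule dvd_weights_imp_dvd)
    fix i assume "i \<le> d"
    show "int h dvd del * int (lam i)"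
    proof (cases "i = d")
      case True
      \<comment> \<open>The divisibility is known for \<open>i < d\<close>; the last weight is
        \<open>h\<close> minus the others.\<close>
      have "int h = (\<Sum>j<d. int (lam j)) + int (lam d)"
        unfolding h_eq by (simp add: lessThan_Suc_atMost[symmetric])
      then have "del * int (lam d) = del * int h - (\<Sum>j<d. del * int (lam j))"
        by (simp add: sum_distrib_left[symmetric] algebra_simps)
      moreover have "int h dvd (\<Sum>j<d. del * int (lam j))"
        using dvd by (intro dvd_sum) auto
      ultimately show ?thesis unfolding True by simp
    qed (use dvd \<open>i \<le> d\<close> in auto)
  qed
  then have "del = 0"
    using dvd_imp_le_int[of del "int h"] k by (fastforce simp: del_def)
  then show "p = p'" unfolding pe
    using \<open>r = r'\<close> \<open>z = z'\<close> by (simp add: del_def)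
qed

text \<open>The factor \<open>h * lattice_index ^ d\<close> is kept apart, since it cancels against
  the size of the target.\<close>

lemma card_boxes:
  assumes "finite X" "card X = lattice_index"
  shows "card (X \<times> {..<h} \<times> PiE {..<d} (\<lambda>i. {..<lattice_index * lam i})) = (lattice_index * (\<Prod>i<d. lam i)) * (h * lattice_index ^ d)"
  using assms by (simp add: card_cartesian_product card_PiE prod.distrib)

lemma card_box_target:
  "card (PiE {..<d} (\<lambda>_. {0..<int (lattice_index * h)})) = h ^ (d - 1) * (h * lattice_index ^ d)"
proof -
  have "h ^ d = h ^ (d - 1) * h" using d_pos by (cases d) auto
  then show ?thesis by (simp add: card_PiE power_mult_distrib mult_ac del: of_nat_mult)
qed

lemma box_translate_target:
  "box_translate ` A \<subseteq> PiE {..<d} (\<lambda>_. {0..<int (lattice_index * h)})"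
  unfolding image_subset_iff box_translate_def
  using lattice_index_pos h_pos by (simp add: split_beta restrict_PiE_iff)

text \<open>In terms of volumes: in the first \<open>d\<close> coordinates the vertex sublattice has
  covolume \<open>1 / h\<close> and the whole lattice \<open>1 / (h * lattice_index)\<close>, which
  is at least the volume of a box with sides \<open>b i\<close>.\<close>

lemma lattice_index_prod_le: "lattice_index * (\<Prod>i<d. lam i) \<le> h ^ (d - 1)"
proof -
  obtain X where X: "X \<subseteq> lattice_points" "finite X" "card X = lattice_index"
    "\<And>r r'. r \<in> X \<Longrightarrow> r' \<in> X \<Longrightarrow> r - r' \<in> vertex_sublattice vertex_hull \<Longrightarrow> r = r'"
    using coset_representatives[OF fano_simplex_vertex_hull] unfolding lattice_index_def by metis
  have "card (X \<times> {..<h} \<times> PiE {..<d} (\<lambda>i. {..<lattice_index * lam i}))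
      \<le> card (PiE {..<d} (\<lambda>_. {0..<int (lattice_index * h)}))"
    by (rule card_inj_on_le[OF inj_on_box_translate[OF X(1,4)] box_translate_target]) (auto intro: finite_PiE)
  then show ?thesis
    unfolding card_boxes[OF X(2,3)] card_box_target using h_pos lattice_index_pos by simp
qed

text \<open>Equality makes the injection of boxes into residues a bijection. So every point whose
  coordinates are multiples of \<open>1 / (lattice_index * h)\<close> lies in the half-open box at
  some lattice point \<open>x\<close>; \<open>z\<close> is its position there.\<close>

lemma box_cover:
  fixes c :: "nat \<Rightarrow> int"
  assumes eq: "lattice_index * (\<Prod>i<d. lam i) = h ^ (d - 1)"
  obtains x z where "x \<in> lattice_points"
    and "\<And>i. i < d \<Longrightarrow> 0 \<le> z i \<and> z i < b i"
    and "\<And>i. i < d \<Longrightarrow> y i x = of_int (c i) / real (lattice_index * h) - z i"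
proof -
  obtain X where X: "X \<subseteq> lattice_points" "finite X" "card X = lattice_index"
    "\<And>r r'. r \<in> X \<Longrightarrow> r' \<in> X \<Longrightarrow> r - r' \<in> vertex_sublattice vertex_hull \<Longrightarrow> r = r'"
    using coset_representatives[OF fano_simplex_vertex_hull] unfolding lattice_index_def by metis
  define D where "D = X \<times> {..<h} \<times> PiE {..<d} (\<lambda>i. {..<lattice_index * lam i})"
  define Q where "Q = lattice_index * h"
  have Q: "0 < Q" unfolding Q_def using lattice_index_pos h_pos by simp
  have "box_translate ` D = PiE {..<d} (\<lambda>_. {0..<int Q})"
  proof (rule card_subset_eq)
    show "card (box_translate ` D) = card (PiE {..<d} (\<lambda>_. {0..<int Q}))"
      using card_image[OF inj_on_box_translate[OF X(1,4)]]
      unfolding D_def Q_def card_box_target card_boxes[OF X(2,3)] eq .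
  qed (use box_translate_target in \<open>auto simp: Q_def intro!: finite_PiE\<close>)
  moreover have "(\<lambda>i\<in>{..<d}. c i mod int Q) \<in> PiE {..<d} (\<lambda>_. {0..<int Q})"
    using Q by auto
  ultimately have "(\<lambda>i\<in>{..<d}. c i mod int Q) \<in> box_translate ` D" by simp
  then obtain p where p: "(\<lambda>i\<in>{..<d}. c i mod int Q) = box_translate p" "p \<in> D"
    by (rule imageE)
  obtain r k z where pe: "p = (r, k, z)" by (cases p)
  have r: "r \<in> lattice_points" and z: "z \<in> PiE {..<d} (\<lambda>i. {..<lattice_index * lam i})"
    using p(2) X(1) by (auto simp: pe D_def)
  have "\<exists>n. c i - (int (z i) + scaled_y i r + int k * int (lattice_index * lam i)) = int Q * n" if "i < d" for i
  proof -
    have "c i mod int Q = (int (z i) + scaled_y i r + int k * int (lattice_index * lam i)) mod int Q"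
      using fun_cong[OF p(1), of i] that by (simp add: box_translate_def Q_def pe)
    then show ?thesis by (simp add: mod_eq_dvd_iff dvd_def)
  qed
  then obtain n where n: "\<And>i. i < d \<Longrightarrow>
      c i - (int (z i) + scaled_y i r + int k * int (lattice_index * lam i)) = int Q * n i"
    by metis
  obtain x' where x': "x' \<in> lattice_points"
      "\<And>i. i < d \<Longrightarrow> y i x' = of_int (n i) - of_int (- int k) * b i"
    using combination_with_sum[of n "- int k"] by blast
  show ?thesis
  proof (rule that[of "r + x'" "\<lambda>i. real (z i) / real Q"])
    show "r + x' \<in> lattice_points" using r x' by (intro lattice_points_add)
    fix i assume i: "i < d"
    have 1: "real Q * y i r = of_int (scaled_y i r)"
      using of_int_scaled_y[OF r, of i] i by (simp add: Q_def)
    have 2: "real Q * b i = real (lattice_index * lam i)" unfolding Q_def by (rule scaled_b)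
    have 3: "z i < lattice_index * lam i" using PiE_mem[OF z, of i] i by simp
    then have "real (z i) < real Q * b i" unfolding 2 by (simp only: of_nat_less_iff)
    then show "0 \<le> real (z i) / real Q \<and> real (z i) / real Q < b i"
      using Q by (simp add: field_simps)
    have "of_int (c i) - (real (z i) + of_int (scaled_y i r) + real k * real (lattice_index * lam i)) = real Q * of_int (n i)"
      using arg_cong[OF n[OF i], of real_of_int] by simp
    then have "real Q * y i (r + x') = of_int (c i) - real (z i)"
      unfolding y_add x'(2)[OF i] distrib_left right_diff_distrib 1 using 2
      by (simp add: algebra_simps)
    then show "y i (r + x') = of_int (c i) / real (lattice_index * h) - real (z i) / real Q"
      using Q unfolding Q_def[symmetric] by (simp add: field_simps)
  qed
qed

end


section \<open>Uniqueness\<close>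

context simplex_coordinates
begin

lemma y_surj:
  obtains x where "\<And>i. i < d \<Longrightarrow> y i x = c i"
proof -
  define C where "C i = (if i < d then c i else - (\<Sum>i<d. c i))" for i
  have "(\<Sum>i\<le>d. C i) = (\<Sum>i<d. C i) + C d"
    by (simp add: lessThan_Suc_atMost[symmetric])
  also have "\<dots> = 0" by (simp add: C_def)
  finally have "y i (\<Sum>i\<le>d. C i *\<^sub>R v i) = c i" if "i < d" for i
    using y_combination[of i C] that by (simp add: C_def)
  then show ?thesis by (rule that)
qed

end

text \<open>Both lattices are given by the same condition on coordinates, so the linear map that
  carries the coordinates over preserves them, and it maps vertices to vertices.\<close>

lemma vertex_hull_isomorphic:
  fixes v v' :: "nat \<Rightarrow> real ^ 'n::finite"
  assumes "simplex_coordinates v y b d" "simplex_coordinates v' y' b' d"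
    and b: "\<And>i. i \<le> d \<Longrightarrow> b i = b' i"
    and L: "\<And>x. x \<in> lattice_points \<longleftrightarrow> (\<forall>i<d. y i x / b i \<in> \<int>)"
    and L': "\<And>x. x \<in> lattice_points \<longleftrightarrow> (\<forall>i<d. y' i x / b' i \<in> \<int>)"
  shows "fwps_isomorphic (convex hull (v ` {..d})) (convex hull (v' ` {..d}))"
proof -
  interpret A: simplex_coordinates v y b d by fact
  interpret B: simplex_coordinates v' y' b' d by fact
  define f where "f x = (\<Sum>i\<le>d. y i x *\<^sub>R v' i)" for x
  have yf: "y' i (f x) = y i x" if "i \<le> d" for i x
    unfolding f_def B.y_combination[OF that] by (simp add: A.y_sum)
  have lin: "linear f"
    by (rule linearI)
      (simp_all add: f_def A.y_add A.y_scaleR scaleR_left_distrib sum.distrib scaleR_sum_right)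
  have "inj f"
  proof (rule injI)
    fix x z assume "f x = f z"
    then show "x = z" using yf by (intro A.y_ext) metis
  qed
  then have bij: "bij f"
    using linear_injective_imp_surjective[OF lin] by (simp add: bij_def)
  have fL: "f x \<in> lattice_points \<longleftrightarrow> x \<in> lattice_points" for x
    unfolding L[of x] L'[of "f x"] using yf b by simp
  have "f ` lattice_points = lattice_points"
  proof (intro equalityI subsetI)
    fix z :: "real ^ 'n" assume z: "z \<in> lattice_points"
    obtain x where "z = f x" using bij by (metis bij_pointE)
    then show "z \<in> f ` lattice_points" using fL z by auto
  qed (use fL in auto)
  moreover have "f (v i) = v' i" if "i \<le> d" for i
    using that by (intro B.y_ext) (simp add: yf A.y_vertex B.y_vertex b)
  then have "f ` v ` {..d} = v' ` {..d}"
    unfolding image_image by (intro image_cong) auto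
  then have "f ` (convex hull (v ` {..d})) = convex hull (v' ` {..d})"
    using convex_hull_linear_image[OF lin, of "v ` {..d}"] by simp
  ultimately show ?thesis
    unfolding fwps_isomorphic_def using lin bij by blast
qed

text \<open>From index \<open>n\<close> on the denominators equal \<open>h\<close>, that is, the
  weights are 1; before it they are pairwise coprime. Lattice points for the two ranges are produced
  by different means, the tiling for the tail and congruences for the head.\<close>

locale extremal_simplex = canonical_simplex v y b d lam h
  for v :: "nat \<Rightarrow> real ^ 'n::finite" and y :: "nat \<Rightarrow> real ^ 'n \<Rightarrow> real"
    and b :: "nat \<Rightarrow> real" and d :: nat and lam :: "nat \<Rightarrow> nat" and h :: nat +
  fixes a :: "nat \<Rightarrow> nat" and n :: nat
  assumes index_eq: "lattice_index * (\<Prod>i<d. lam i) = h ^ (d - 1)"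
    and a_pos: "i \<le> d \<Longrightarrow> 0 < a i"
    and b_a: "i \<le> d \<Longrightarrow> b i = 1 / real (a i)"
    and a_tail: "n \<le> i \<Longrightarrow> i \<le> d \<Longrightarrow> a i = h"
    and n_le: "n \<le> d"
    and a_coprime: "i < n \<Longrightarrow> j < n \<Longrightarrow> i \<noteq> j \<Longrightarrow> coprime (a i) (a j)"
begin

text \<open>
  The box at the target point is not empty; its lattice point has last coordinate at most \<open>- b d\<close>,
  since it would lie in the interior of the simplex otherwise.  The coordinates sum to zero, so this
  leaves no room for it to differ from the target.
\<close>

lemma tail_point:
  assumes k: "n \<le> k" "k < d"
  obtains x where "x \<in> lattice_points" "\<And>i. i < d \<Longrightarrow> y i x = of_bool (i = k) / real h"
proof -
  have bk: "b k = 1 / real h" "b d = 1 / real h" using k b_a a_tail n_le by auto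
  then have lam: "lam k = 1" using b_eq[of k] h_pos by simp
  \<comment> \<open>The scaled target has the entry \<open>lattice_index\<close> at
    \<open>k\<close>, which is \<open>1 / h\<close> before scaling.\<close>
  obtain x z where x: "x \<in> lattice_points"
    and z: "\<And>i. i < d \<Longrightarrow> 0 \<le> z i \<and> z i < b i"
    and yx: "\<And>i. i < d \<Longrightarrow> y i x = of_int (of_bool (i = k) * int lattice_index) / real (lattice_index * h) - z i"
    using box_cover[OF index_eq, of "\<lambda>i. of_bool (i = k) * int lattice_index"] by metis
  have yx': "y i x = of_bool (i = k) / real h - z i" if "i < d" for i
    using yx[OF that] lattice_index_pos by (cases "i = k") auto
  have "y d x \<le> - b d"
  proof (rule ccontr)
    assume *: "\<not> ?thesis"
    have "x = 0"
    proof (rule canonical[OF x])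
      fix i assume "i \<le> d"
      show "- b i < y i x"
      proof (cases "i < d")
        case True
        have "0 \<le> of_bool (i = k) / real h" by simp
        then show ?thesis using z[OF True] yx'[OF True] by linarith
      next
        case False
        then show ?thesis using * \<open>i \<le> d\<close> by simp
      qed
    qed
    then show False using yx'[OF k(2)] z[OF k(2)] bk by simp
  qed
  moreover have "y d x = - (\<Sum>i<d. of_bool (i = k) / real h) + (\<Sum>i<d. z i)"
    using y_last[of x] yx' by (simp add: sum_subtractf)
  moreover have "(\<Sum>i<d. of_bool (i = k) / real h) = 1 / real h"
    using k by (subst sum.remove[of _ k]) auto
  ultimately have "(\<Sum>i<d. z i) \<le> 0" using bk by simp
  moreover have "0 \<le> (\<Sum>i<d. z i)" using z by (intro sum_nonneg) auto
  ultimately have "(\<Sum>i<d. z i) = 0" by simp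
  then have "z i = 0" if "i < d" for i
    using that z sum_nonneg_eq_0_iff[of "{..<d}" z] by auto
  then show ?thesis using x yx' by (intro that[of x]) auto
qed

text \<open>By the Chinese remainder theorem such a point exists already in the sublattice of the vertices.\<close>

lemma head_point:
  assumes k: "k < n"
  obtains x where "x \<in> lattice_points" "\<And>i. i < n \<Longrightarrow> y i x = of_bool (i = k) / real (a i)"
    "\<And>i. n \<le> i \<Longrightarrow> i < d \<Longrightarrow> real h * y i x \<in> \<int>"
proof -
  obtain K where K: "\<forall>i\<in>{..<n}. [K = of_bool (i = k)] (mod a i)"
    using chinese_remainder_nat[of "{..<n}" a "\<lambda>i. of_bool (i = k)"] a_coprime by auto
  have "\<exists>q. of_bool (i = k) = int K + q * int (a i)" if "i < n" for i
  proof -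
    have "[int K = int (of_bool (i = k))] (mod int (a i))"
      using K that by (metis lessThan_iff cong_int_iff)
    then show ?thesis by (auto simp: cong_iff_lin mult.commute)
  qed
  then obtain q where q: "\<And>i. i < n \<Longrightarrow> of_bool (i = k) = int K + q i * int (a i)" by metis
  \<comment> \<open>With coefficient sum \<open>- K\<close>, coordinate \<open>i < n\<close> is
    \<open>(K + q i * a i) / a i\<close>; on the tail, where the coefficients are 0, it is
    \<open>K / h\<close>.\<close>
  obtain x where x: "x \<in> lattice_points"
    "\<And>i. i < d \<Longrightarrow> y i x = of_int (if i < n then q i else 0) - of_int (- int K) * b i"
    using combination_with_sum[of "\<lambda>i. if i < n then q i else 0" "- int K"] by blast
  show ?thesis
  proof (rule that[OF x(1)])
    fix i assume i: "i < n"
    have "real_of_int (of_bool (i = k)) = real K + of_int (q i) * real (a i)"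
      using arg_cong[OF q[OF i], of real_of_int] by simp
    then show "y i x = of_bool (i = k) / real (a i)"
      using x(2)[of i] i n_le b_a[of i] a_pos[of i] by (simp add: field_simps)
  next
    fix i assume i: "n \<le> i" "i < d"
    then have "real h * y i x = real K"
      using x(2)[of i] b_a[of i] a_tail[of i] h_pos by simp
    then show "real h * y i x \<in> \<int>" by simp
  qed
qed

text \<open>Subtracting multiples of the head points clears the first \<open>n\<close> coordinates.
  The others remain multiples of \<open>1 / h\<close>, which is all that is known of head points
  there, and are then cleared by the tail points.\<close>

lemma lattice_pointI:
  assumes "\<And>i. i < d \<Longrightarrow> real (a i) * y i x \<in> \<int>"
  shows "x \<in> lattice_points"
proof -
  obtain m where m: "\<And>i. i < d \<Longrightarrow> real (a i) * y i x = of_int (m i)"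
  proof -
    have "\<forall>i. \<exists>m. i < d \<longrightarrow> real (a i) * y i x = of_int m"
      using assms unfolding Ints_def by blast
    then show ?thesis using that by metis
  qed
  have "\<exists>p. k < n \<longrightarrow> p \<in> lattice_points \<and> (\<forall>i<n. y i p = of_bool (i = k) / real (a i)) \<and>
      (\<forall>i. n \<le> i \<longrightarrow> i < d \<longrightarrow> real h * y i p \<in> \<int>)" for k
  proof (cases "k < n")
    case True
    then show ?thesis by (rule head_point) blast
  qed simp
  then obtain p where p: "\<And>k. k < n \<Longrightarrow> p k \<in> lattice_points"
    "\<And>k i. k < n \<Longrightarrow> i < n \<Longrightarrow> y i (p k) = of_bool (i = k) / real (a i)"
    "\<And>k i. k < n \<Longrightarrow> n \<le> i \<Longrightarrow> i < d \<Longrightarrow> real h * y i (p k) \<in> \<int>"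
    by metis
  have "\<exists>q. n \<le> k \<longrightarrow> k < d \<longrightarrow> q \<in> lattice_points \<and> (\<forall>i<d. y i q = of_bool (i = k) / real h)" for k
  proof (cases "n \<le> k \<and> k < d")
    case True
    then have "n \<le> k" "k < d" by auto
    then show ?thesis by (rule tail_point) blast
  qed auto
  then obtain q where q: "\<And>k. n \<le> k \<Longrightarrow> k < d \<Longrightarrow> q k \<in> lattice_points"
    "\<And>k i. n \<le> k \<Longrightarrow> k < d \<Longrightarrow> i < d \<Longrightarrow> y i (q k) = of_bool (i = k) / real h"
    by metis
  have y_sum': "y i (\<Sum>k\<in>A. of_int (c k) *\<^sub>R g k) = (\<Sum>k\<in>A. of_int (c k) * y i (g k))"
    for i c and A :: "nat set" and g
    by (simp add: linear_sum[OF y_linear] y_scaleR)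
  define x1 where "x1 = x - (\<Sum>k<n. of_int (m k) *\<^sub>R p k)"
  have x1_head: "y i x1 = 0" if "i < n" for i
  proof -
    have "(\<Sum>k<n. of_int (m k) * y i (p k)) = (\<Sum>k<n. of_int (m k) * (of_bool (i = k) / real (a i)))"
      using p(2) that by (intro sum.cong) auto
    also have "\<dots> = of_int (m i) / real (a i)"
      using that by (subst sum.remove[of _ i]) auto
    also have "\<dots> = y i x" using m[of i] a_pos[of i] that n_le by (simp add: field_simps)
    finally show ?thesis by (simp add: x1_def y_diff y_sum')
  qed
  have "real h * y i x1 \<in> \<int>" if i: "n \<le> i" "i < d" for i
  proof -
    have "real h * y i x1 = real h * y i x - (\<Sum>k<n. of_int (m k) * (real h * y i (p k)))"
      by (simp add: x1_def y_diff y_sum' right_diff_distrib sum_distrib_left mult_ac)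
    also have "\<dots> \<in> \<int>"
    proof (rule Ints_diff)
      show "real h * y i x \<in> \<int>" using m[of i] a_tail[of i] i by simp
    qed (intro Ints_sum Ints_mult Ints_of_int p(3), use i in auto)
    finally show ?thesis .
  qed
  then have "\<forall>i. \<exists>c. n \<le> i \<longrightarrow> i < d \<longrightarrow> real h * y i x1 = of_int c"
    unfolding Ints_def by blast
  then obtain c where c: "\<And>i. n \<le> i \<Longrightarrow> i < d \<Longrightarrow> real h * y i x1 = of_int (c i)" by metis
  define x2 where "x2 = x1 - (\<Sum>k=n..<d. of_int (c k) *\<^sub>R q k)"
  have "y i x2 = 0" if i: "i < d" for i
  proof -
    have "(\<Sum>k=n..<d. of_int (c k) * y i (q k)) = (\<Sum>k=n..<d. of_int (c k) * (of_bool (i = k) / real h))"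
      using q(2) i by (intro sum.cong) auto
    also have "\<dots> = y i x1"
    proof (cases "n \<le> i")
      case True
      then have "(\<Sum>k=n..<d. of_int (c k) * (of_bool (i = k) / real h)) = of_int (c i) / real h"
        using i by (subst sum.remove[of _ i]) auto
      also have "\<dots> = y i x1" using c[OF True i] h_pos by (simp add: field_simps)
      finally show ?thesis .
    next
      case False
      then have "(\<Sum>k=n..<d. of_int (c k) * (of_bool (i = k) / real h)) = 0"
        by (intro sum.neutral) auto
      then show ?thesis using x1_head False by simp
    qed
    finally show ?thesis by (simp add: x2_def y_diff y_sum')
  qed
  then have "x2 = 0" using y_eq_0_iff by blast
  then have "x = (\<Sum>k<n. of_int (m k) *\<^sub>R p k) + (\<Sum>k=n..<d. of_int (c k) *\<^sub>R q k)"
    by (simp add: x2_def x1_def diff_eq_eq add.commute)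
  also have "\<dots> \<in> lattice_points"
    using p(1) q(1) by (intro lattice_points_add lattice_points_sum lattice_points_int) auto
  finally show ?thesis .
qed

text \<open>Rounding the first \<open>d\<close> coordinates of a lattice point down to multiples of
  \<open>b i\<close> gives a lattice point again; the difference lies in the box at the origin, so
  it vanishes.\<close>

lemma lattice_points_iff: "x \<in> lattice_points \<longleftrightarrow> (\<forall>i<d. y i x / b i \<in> \<int>)"
proof -
  have eq: "y i x / b i = real (a i) * y i x" if "i < d" for i x
    using b_a[of i] that by simp
  show ?thesis
  proof
    assume "\<forall>i<d. y i x / b i \<in> \<int>"
    then show "x \<in> lattice_points" using eq by (intro lattice_pointI) auto
  next
    assume x: "x \<in> lattice_points"
    obtain w where w: "\<And>i. i < d \<Longrightarrow> y i w = of_int \<lfloor>real (a i) * y i x\<rfloor> / real (a i)"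
      using y_surj[of "\<lambda>i. of_int \<lfloor>real (a i) * y i x\<rfloor> / real (a i)"] by blast
    have aw: "real (a i) * y i w = of_int \<lfloor>real (a i) * y i x\<rfloor>" if "i < d" for i
      using w[OF that] a_pos[of i] that by simp
    have "w \<in> lattice_points" using aw by (intro lattice_pointI) simp
    then have "x - w \<in> lattice_points" using x by (intro lattice_points_diff)
    then have "x - w = 0"
    proof (rule small_lattice_point[of _ d])
      fix i assume "i \<le> d" "i \<noteq> d"
      then have i: "i < d" by simp
      have "real (a i) * y i (x - w) = frac (real (a i) * y i x)"
        by (simp add: y_diff right_diff_distrib aw[OF i] frac_def)
      moreover have "0 \<le> frac (real (a i) * y i x)" "frac (real (a i) * y i x) < 1"
        by (rule frac_ge_0, rule frac_lt_1)
      ultimately have "\<bar>real (a i) * y i (x - w)\<bar> < 1" by simp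
      then show "\<bar>y i (x - w)\<bar> < b i"
        using b_a[of i] a_pos[of i] i by (simp add: abs_mult pos_less_divide_eq mult.commute)
    qed simp
    then have xw: "x = w" by simp
    have "y i x / b i \<in> \<int>" if "i < d" for i
    proof -
      have "y i x / b i = real (a i) * y i w" using eq[OF that, of x] by (simp only: xw)
      also have "\<dots> = of_int \<lfloor>real (a i) * y i x\<rfloor>" by (rule aw[OF that])
      finally show ?thesis by (simp only: Ints_of_int)
    qed
    then show "\<forall>i<d. y i x / b i \<in> \<int>" by blast
  qed
qed

end

section \<open>The multiplicity bound for nonincreasing weights\<close>

lemma coprime_sylvester:
  assumes "i < j"
  shows "coprime (sylvester (Suc i)) (sylvester (Suc j))"
proof -
  have "sylvester (Suc i) dvd sylvester_prod j"
    unfolding sylvester_prod_def using assms by (intro dvd_prodI) auto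
  then have "coprime (sylvester (Suc i)) (sylvester_prod j + 1)"
    by (metis coprime_add_one_right coprime_divisors dvd_refl)
  then show ?thesis by (simp add: sylvester_Suc[of j])
qed

locale sorted_canonical_simplex = canonical_simplex +
  assumes lam_antimono: "i \<le> j \<Longrightarrow> j \<le> d \<Longrightarrow> lam j \<le> lam i"
begin

sublocale product_sum_sequence b d
proof
  show "b j \<le> b i" if "i \<le> j" "j \<le> d" for i j
    using lam_antimono[OF that] h_pos by (simp add: b_eq divide_right_mono)
  fix j assume j: "j \<le> d"
  show "(\<Prod>i<j. b i) \<le> 1 - (\<Sum>i<j. b i)"
  proof (cases j)
    case (Suc k)
    define s where "s = (\<Sum>i=j..d. lam i)"
    have "(\<Prod>i<j. lam i) \<le> h ^ k * s"
      unfolding Suc s_def using j Suc by (intro prod_weights_le) auto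
    then have "real (\<Prod>i<j. lam i) \<le> real (h ^ k * s)" by (simp only: of_nat_le_iff)
    then have *: "real (\<Prod>i<j. lam i) / real h ^ j \<le> real h ^ k * real s / real h ^ j"
      using h_pos by (intro divide_right_mono) auto
    have "{..d} = {..<j} \<union> {j..d}" using j by auto
    then have "(\<Sum>i\<le>d. b i) = (\<Sum>i<j. b i) + (\<Sum>i=j..d. b i)"
      by (simp add: sum.union_disjoint ivl_disj_int)
    moreover have "(\<Sum>i=j..d. b i) = real s / real h"
      by (simp add: s_def b_eq sum_divide_distrib)
    ultimately have "1 - (\<Sum>i<j. b i) = real s / real h"
      using b_sum by linarith
    moreover have "(\<Prod>i<j. b i) = real (\<Prod>i<j. lam i) / real h ^ j"
      by (simp add: b_eq prod_dividef)
    ultimately show ?thesis using * h_pos by (simp add: Suc)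
  qed simp
qed (fact b_pos, fact b_sum)

text \<open>With \<open>P\<close> the product of the first \<open>d - 1\<close> weights, the packing
  bound is \<open>lattice_index * lam (d - 1) * P \<le> h ^ (d - 1)\<close>, and the minimal product
  gives \<open>h ^ (d - 1) \<le> max_mult d * P\<close>. Maximality forces
  \<open>lam (d - 1) = 1\<close>, so \<open>lam d = 1\<close>, and equality in both. The minimal
  product is available from \<open>d = 2\<close> on; for \<open>d = 1\<close> the packing bound
  alone makes the index and the weights 1.\<close>

lemma lattice_index_le: "lattice_index \<le> max_mult d"
  and lattice_index_eq: "lattice_index = max_mult d \<Longrightarrow>
    lattice_index * (\<Prod>i<d. lam i) = h ^ (d - 1) \<and> lam d = 1 \<and>
    (\<forall>i\<le>d. b i = 1 / real (extremal_denominator d i))"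
proof -
  have "lattice_index \<le> max_mult d \<and> (lattice_index = max_mult d \<longrightarrow>
    lattice_index * (\<Prod>i<d. lam i) = h ^ (d - 1) \<and> lam d = 1 \<and>
    (\<forall>i\<le>d. b i = 1 / real (extremal_denominator d i)))"
  proof (cases "d = 1")
    case True
    have le: "lattice_index * lam 0 \<le> 1" using lattice_index_prod_le True by simp
    moreover have "1 \<le> lattice_index" "1 \<le> lam 0" "1 \<le> lam 1"
      using lattice_index_pos lam_pos[of 0] lam_pos[of 1] True by auto
    ultimately have 1: "lattice_index = 1" "lam 0 = 1"
      by (metis le_antisym mult_le_mono mult.right_neutral mult.left_neutral le_trans nat_mult_eq_1_iff)+
    moreover have "lam 1 = 1" using lam_antimono[of 0 1] 1 \<open>1 \<le> lam 1\<close> True by simp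
    moreover have "h = 2" using h_eq True calculation by simp
    ultimately show ?thesis using True
      by (auto simp: max_mult_def head_length_def extremal_denominator_def b_eq le_Suc_eq)
  next
    case False
    then have d: "2 \<le> d" using d_pos by simp
    define e where "e = d - 1"
    have de: "d = Suc e" using d by (simp add: e_def)
    define P where "P = (\<Prod>i<e. lam i)"
    have P: "0 < P" unfolding P_def using lam_pos de by (intro prod_pos) auto
    have M: "0 < max_mult d"
    proof -
      have "head_length d < d + 1" by (auto simp: head_length_def)
      then show ?thesis using sylvester_prod_pos by (simp add: max_mult_def)
    qed
    have b_prod: "(\<Prod>i<d - 1. b i) = real P / real h ^ e"
      by (simp add: b_eq prod_dividef P_def e_def)
    have "1 / real (max_mult d) \<le> real P / real h ^ e"
      using prod_ge_inverse_max_mult(1)[OF d] b_prod by simp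
    then have "real (h ^ e) \<le> real (max_mult d * P)"
      using h_pos M by (simp add: field_simps)
    then have h_le: "h ^ e \<le> max_mult d * P" by (simp only: of_nat_le_iff)
    have le: "lattice_index * lam e * P \<le> h ^ e"
      using lattice_index_prod_le by (simp add: de P_def mult_ac)
    have "lattice_index * lam e * P \<le> max_mult d * P" using le h_le by linarith
    then have il: "lattice_index * lam e \<le> max_mult d" using P by simp
    have lam_e: "1 \<le> lam e" "1 \<le> lam d" "lam d \<le> lam e"
      using lam_pos[of e] lam_pos[of d] lam_antimono[of e d] de by auto
    have "lattice_index * 1 \<le> lattice_index * lam e" using lam_e by (intro mult_le_mono) auto
    then have "lattice_index \<le> max_mult d" using il by linarith
    moreover have "lattice_index * (\<Prod>i<d. lam i) = h ^ (d - 1) \<and> lam d = 1 \<and>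
      (\<forall>i\<le>d. b i = 1 / real (extremal_denominator d i))" if eq: "lattice_index = max_mult d"
    proof -
      have "max_mult d * lam e \<le> max_mult d * 1" using il eq by simp
      then have "lam e = 1" using M lam_e by simp
      then have "max_mult d * P = h ^ e" using le h_le eq by simp
      moreover from this have "real (max_mult d) * real P = real h ^ e"
        by (metis of_nat_mult of_nat_power)
      then have "1 / real (max_mult d) = (\<Prod>i<d - 1. b i)"
        unfolding b_prod using M h_pos P by (simp add: field_simps)
      then have "\<forall>i\<le>d. b i = 1 / real (extremal_denominator d i)"
        using prod_ge_inverse_max_mult(2)[OF d] by blast
      ultimately show ?thesis
        using eq \<open>lam e = 1\<close> lam_e by (simp add: de P_def)
    qed
    ultimately show ?thesis by blast
  qed
  then show "lattice_index \<le> max_mult d" and "lattice_index = max_mult d \<Longrightarrow>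
    lattice_index * (\<Prod>i<d. lam i) = h ^ (d - 1) \<and> lam d = 1 \<and>
    (\<forall>i\<le>d. b i = 1 / real (extremal_denominator d i))" by blast+
qed

lemma lattice_points_iff_if_maximal:
  assumes "lattice_index = max_mult d"
  shows "x \<in> lattice_points \<longleftrightarrow> (\<forall>i<d. y i x / b i \<in> \<int>)"
proof -
  note eq = lattice_index_eq[OF assms]
  have n: "head_length d \<le> d" by (simp add: head_length_def)
  \<comment> \<open>The last weight is 1, so the last extremal denominator is
    \<open>h\<close>.\<close>
  have "1 / real h = 1 / real (extremal_denominator d d)"
    using eq b_eq[of d] by auto
  then have h: "extremal_denominator d d = h" by simp
  interpret extremal_simplex v y b d lam h "extremal_denominator d" "head_length d"
  proof
    show "0 < extremal_denominator d i" if "i \<le> d" for i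
      using b_pos[OF that] eq that by (cases "extremal_denominator d i") auto
    show "extremal_denominator d i = h" if "head_length d \<le> i" "i \<le> d" for i
      using that n by (simp add: extremal_denominator_def flip: h)
    show "coprime (extremal_denominator d i) (extremal_denominator d j)"
      if "i < head_length d" "j < head_length d" "i \<noteq> j" for i j
      using that coprime_sylvester[of i j] coprime_sylvester[of j i]
      by (cases "i < j") (auto simp: extremal_denominator_def coprime_commute)
  qed (use eq n in auto)
  show ?thesis by (rule lattice_points_iff)
qed

end


section \<open>Weights of a Fano simplex\<close>

lemma finite_bounded_lattice_points:
  "finite {x :: real ^ 'n::finite. x \<in> lattice_points \<and> norm x \<le> R}"
proof -
  let ?K = "{k :: real. k \<in> \<int> \<and> \<bar>k\<bar> \<le> R}"
  have "finite (vec_lambda ` (PiE (UNIV :: 'n set) (\<lambda>_. ?K)))"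
    by (intro finite_imageI finite_PiE) (auto simp: finite_abs_int_segment)
  moreover have "{x :: real ^ 'n. x \<in> lattice_points \<and> norm x \<le> R} \<subseteq> vec_lambda ` (PiE UNIV (\<lambda>_. ?K))"
  proof
    fix x :: "real ^ 'n" assume x: "x \<in> {x. x \<in> lattice_points \<and> norm x \<le> R}"
    have "\<bar>x $ i\<bar> \<le> R" for i
      using x component_le_norm_cart[of x i] by simp
    then show "x \<in> vec_lambda ` (PiE UNIV (\<lambda>_. ?K))"
      using x by (intro image_eqI[of _ _ "vec_nth x"]) (auto simp: lattice_points_def)
  qed
  ultimately show ?thesis by (rule rev_finite_subset)
qed

text \<open>
  A relation with positive real coefficients yields one with positive integers: two multiples of it
  have the same rounded-down lattice point.
\<close>

lemma integral_relation:
  fixes C :: "(real ^ 'n::finite) set"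
  assumes C: "finite C" "C \<noteq> {}" "C \<subseteq> lattice_points"
    and pos: "\<And>v. v \<in> C \<Longrightarrow> 0 < \<beta> v" and rel: "(\<Sum>v\<in>C. \<beta> v *\<^sub>R v) = 0"
    and unique: "\<And>c. (\<Sum>v\<in>C. c v *\<^sub>R v) = 0 \<Longrightarrow> \<forall>v\<in>C. c v = sum c C * \<beta> v"
  obtains w :: "real ^ 'n \<Rightarrow> nat" where "\<forall>v\<in>C. 0 < w v" "(\<Sum>v\<in>C. real (w v) *\<^sub>R v) = 0"
proof -
  define g where "g k = (\<Sum>v\<in>C. of_int \<lfloor>real k * \<beta> v\<rfloor> *\<^sub>R v)" for k :: nat
  define R where "R = (\<Sum>v\<in>C. norm v)"
  have "g k \<in> lattice_points \<and> norm (g k) \<le> R" for k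
  proof
    show "g k \<in> lattice_points"
      unfolding g_def using C by (intro lattice_points_sum lattice_points_int) auto
    have "g k = real k *\<^sub>R (\<Sum>v\<in>C. \<beta> v *\<^sub>R v) - (\<Sum>v\<in>C. frac (real k * \<beta> v) *\<^sub>R v)"
      unfolding g_def frac_def by (simp add: scaleR_sum_right algebra_simps sum_subtractf)
    then have "norm (g k) = norm (\<Sum>v\<in>C. frac (real k * \<beta> v) *\<^sub>R v)"
      by (simp add: rel)
    also have "\<dots> \<le> R"
      unfolding R_def
      by (intro sum_norm_le) (auto simp: frac_ge_0 frac_lt_1 less_imp_le mult_left_le_one_le)
    finally show "norm (g k) \<le> R" .
  qed
  then have "finite (range g)"
    by (intro finite_subset[OF _ finite_bounded_lattice_points[of R]]) auto
  then obtain k0 where "infinite {k \<in> UNIV. g k = g k0}"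
    using pigeonhole_infinite[of "UNIV :: nat set" g] by auto
  then have inf: "\<exists>k>m. g k = g k0" for m
    unfolding infinite_nat_iff_unbounded by auto
  obtain v0 where v0: "v0 \<in> C" using C by auto
  \<comment> \<open>From \<open>k0 + 1 / \<beta> v0\<close> on, the floors at \<open>v0\<close>
    differ by at least 1.\<close>
  obtain k where k: "k > k0 + nat \<lceil>1 / \<beta> v0\<rceil>" "g k = g k0" using inf by blast
  define c where "c v = \<lfloor>real k * \<beta> v\<rfloor> - \<lfloor>real k0 * \<beta> v\<rfloor>" for v
  have "(\<Sum>v\<in>C. real_of_int (c v) *\<^sub>R v) = g k - g k0"
    by (simp add: g_def c_def scaleR_left_diff_distrib sum_subtractf)
  then have crel: "(\<Sum>v\<in>C. real_of_int (c v) *\<^sub>R v) = 0" using k by simp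
  \<comment> \<open>All relations are multiples of \<open>\<beta>\<close>, so the sign at
    \<open>v0\<close> is the sign everywhere.\<close>
  have c_eq: "\<forall>v\<in>C. real_of_int (c v) = (\<Sum>v\<in>C. real_of_int (c v)) * \<beta> v"
    using unique[OF crel] by simp
  have "real k0 + 1 / \<beta> v0 \<le> real k" using k by linarith
  then have "(real k0 + 1 / \<beta> v0) * \<beta> v0 \<le> real k * \<beta> v0"
    using pos[OF v0] by (intro mult_right_mono) auto
  then have "real k0 * \<beta> v0 + 1 \<le> real k * \<beta> v0"
    using pos[OF v0] by (simp add: distrib_right)
  then have "0 < c v0" unfolding c_def by linarith
  then have "0 < (\<Sum>v\<in>C. real_of_int (c v)) * \<beta> v0"
    using c_eq v0 by (metis of_int_0_less_iff)
  then have S: "0 < (\<Sum>v\<in>C. real_of_int (c v))" using pos[OF v0] by (simp add: zero_less_mult_iff)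
  have cpos: "0 < c v" if "v \<in> C" for v
  proof -
    have "0 < (\<Sum>v\<in>C. real_of_int (c v)) * \<beta> v" using S pos[OF that] by simp
    then show ?thesis using c_eq that by (metis of_int_0_less_iff)
  qed
  show ?thesis
  proof (rule that[of "\<lambda>v. nat (c v)"])
    have "(\<Sum>v\<in>C. real (nat (c v)) *\<^sub>R v) = (\<Sum>v\<in>C. real_of_int (c v) *\<^sub>R v)"
      using cpos by (intro sum.cong) (auto simp: less_imp_le)
    then show "(\<Sum>v\<in>C. real (nat (c v)) *\<^sub>R v) = 0" using crel by simp
  qed (use cpos in auto)
qed

text \<open>Uniqueness of the relation makes \<open>v 0, ..., v (d - 1)\<close> a basis. The
  coordinates for this basis are extended by 0 at \<open>v d\<close> and corrected by the multiple
  of \<open>b\<close> that makes their sum 0; this leaves the represented point unchanged.\<close>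

lemma simplex_coordinates_exist:
  fixes v :: "nat \<Rightarrow> real ^ 'n::finite"
  assumes d: "CARD('n) = d" and inj: "inj_on v {..d}"
    and pos: "\<And>i. i \<le> d \<Longrightarrow> 0 < b i" and b_sum: "(\<Sum>i\<le>d. b i) = 1"
    and rel: "(\<Sum>i\<le>d. b i *\<^sub>R v i) = 0"
    and unique: "\<And>c. (\<Sum>i\<le>d. c i *\<^sub>R v i) = 0 \<Longrightarrow> \<forall>i\<le>d. c i = (\<Sum>i\<le>d. c i) * b i"
  obtains y where "simplex_coordinates v y b d"
proof -
  define B where "B = v ` {..<d}"
  have injB: "inj_on v {..<d}" using inj by (rule inj_on_subset) auto
  have cardB: "card B = d" unfolding B_def using card_image[OF injB] by simp
  have indep: "independent B"
  proof
    assume "dependent B"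
    then obtain u where u: "\<exists>x\<in>B. u x \<noteq> 0" "(\<Sum>x\<in>B. u x *\<^sub>R x) = 0"
      using dependent_finite[of B] by (auto simp: B_def)
    define c where "c i = (if i < d then u (v i) else 0)" for i
    have "(\<Sum>i\<le>d. c i *\<^sub>R v i) = (\<Sum>i<d. u (v i) *\<^sub>R v i)"
      by (simp add: c_def lessThan_Suc_atMost[symmetric])
    also have "\<dots> = 0" using u(2) by (simp add: B_def sum.reindex[OF injB])
    finally have c: "\<forall>i\<le>d. c i = (\<Sum>i\<le>d. c i) * b i" by (rule unique)
    have "c d = 0" by (simp add: c_def)
    then have "(\<Sum>i\<le>d. c i) = 0" using c pos[of d] by (metis less_irrefl mult_eq_0_iff order_refl)
    then have "\<forall>i<d. u (v i) = 0" using c by (metis c_def less_imp_le mult_zero_left)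
    then show False using u(1) by (auto simp: B_def)
  qed
  have "dim (UNIV :: (real ^ 'n) set) = d" using d by (simp add: dim_UNIV)
  then have spanB: "span B = UNIV"
    using card_eq_dim[of B UNIV] cardB indep by (auto simp: B_def)
  have "\<exists>g. linear g \<and> (\<forall>x\<in>B. g x = (of_bool (x = v i) :: real))" for i
    by (rule linear_independent_extend[OF indep])
  then obtain g where g_lin: "\<And>i. linear (g i)" and g: "\<And>i x. x \<in> B \<Longrightarrow> g i x = (of_bool (x = v i) :: real)"
    by metis
  have gv: "g i (v j) = of_bool (i = j)" if "i < d" "j < d" for i j
    using g[of "v j" i] inj_onD[OF injB, of i j] that by (auto simp: B_def)
  have repr: "(\<Sum>j<d. g j x *\<^sub>R v j) = x" for x
  proof (rule linear_eq_on_span[of "\<lambda>x. \<Sum>j<d. g j x *\<^sub>R v j" "\<lambda>x. x" B])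
    show "linear (\<lambda>x. \<Sum>j<d. g j x *\<^sub>R v j)"
      by (rule linearI)
        (simp_all add: linear_add[OF g_lin] linear_scale[OF g_lin] scaleR_left_distrib sum.distrib scaleR_sum_right)
    fix x assume "x \<in> B"
    then obtain i where i: "i < d" "x = v i" by (auto simp: B_def)
    have "(\<Sum>j<d. g j x *\<^sub>R v j) = (\<Sum>j<d. of_bool (j = i) *\<^sub>R v j)"
      using gv i by (intro sum.cong) auto
    also have "\<dots> = x" using i by (subst sum.remove[of _ i]) auto
    finally show "(\<Sum>j<d. g j x *\<^sub>R v j) = x" .
  qed (use spanB in \<open>auto intro: linear_ident\<close>)
  define y where "y i x = (if i < d then g i x else 0) - (\<Sum>j<d. g j x) * b i" for i x
  have y_repr: "(\<Sum>i\<le>d. y i x *\<^sub>R v i) = x" for x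
  proof -
    have "(\<Sum>i\<le>d. y i x *\<^sub>R v i) = (\<Sum>i\<le>d. (if i < d then g i x else 0) *\<^sub>R v i) - (\<Sum>j<d. g j x) *\<^sub>R (\<Sum>i\<le>d. b i *\<^sub>R v i)"
      by (simp add: y_def scaleR_left_diff_distrib sum_subtractf scaleR_sum_right)
    also have "(\<Sum>i\<le>d. (if i < d then g i x else 0) *\<^sub>R v i) = (\<Sum>i<d. g i x *\<^sub>R v i)"
      by (simp add: lessThan_Suc_atMost[symmetric])
    finally show ?thesis by (simp add: rel repr)
  qed
  have y_sum: "(\<Sum>i\<le>d. y i x) = 0" for x
  proof -
    have "(\<Sum>i\<le>d. y i x) = (\<Sum>i\<le>d. if i < d then g i x else 0) - (\<Sum>j<d. g j x) * (\<Sum>i\<le>d. b i)"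
      by (simp add: y_def sum_subtractf sum_distrib_left)
    also have "(\<Sum>i\<le>d. if i < d then g i x else 0) = (\<Sum>i<d. g i x)"
      by (simp add: lessThan_Suc_atMost[symmetric])
    finally show ?thesis by (simp add: b_sum)
  qed
  have "simplex_coordinates v y b d"
  proof (rule simplex_coordinates.intro)
    show "linear (y i)" for i
      by (rule linearI)
        (simp_all add: y_def linear_add[OF g_lin] linear_scale[OF g_lin] sum.distrib sum_distrib_left algebra_simps)
    show "y i (v j) = of_bool (i = j) - b i" if "i \<le> d" "j \<le> d" for i j
    proof -
      \<comment> \<open>The coefficients of a relation with sum -1, hence equal to
        \<open>- b\<close>.\<close>
      define c where "c k = y k (v j) - of_bool (k = j)" for k
      have "(\<Sum>k\<le>d. of_bool (k = j) *\<^sub>R v k) = v j"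
        using that by (subst sum.remove[of _ j]) auto
      then have "(\<Sum>k\<le>d. c k *\<^sub>R v k) = 0"
        by (simp add: c_def scaleR_left_diff_distrib sum_subtractf y_repr)
      then have "\<forall>k\<le>d. c k = (\<Sum>k\<le>d. c k) * b k" by (rule unique)
      moreover have "(\<Sum>k\<le>d. of_bool (k = j) :: real) = 1"
        using that by (subst sum.remove[of _ j]) auto
      then have "(\<Sum>k\<le>d. c k) = -1"
        by (simp add: c_def sum_subtractf y_sum)
      ultimately have "c i = - b i" using that by simp
      then show ?thesis by (auto simp: c_def)
    qed
  qed (use d pos b_sum y_repr y_sum in auto)
  then show ?thesis by (rule that)
qed


section \<open>The extremal simplex\<close>

lemma comm_group_quotient_group:
  assumes "fano_simplex P"
  shows "comm_group (quotient_group P)"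
proof -
  interpret L: comm_group "lattice_group :: (real ^ 'n) monoid" by (rule comm_group_lattice)
  show ?thesis
    unfolding quotient_group_def
    by (rule L.abelian_FactGroup[OF subgroup_vertex_sublattice[OF assms]])
qed

context canonical_simplex
begin

text \<open>Replacing \<open>t\<close> by its fractional part gives a lattice point on the segment
  from the origin to the vertex, without the vertex, hence in the interior. So it is the origin, and
  \<open>t\<close> is an integer.\<close>

lemma free_in_codim_one_vertex_hull: "free_in_codim_one vertex_hull"
  unfolding free_in_codim_one_def vertices_vertex_hull
proof (intro ballI allI impI)
  fix w and t :: real
  assume "w \<in> v ` {..d}" and L: "t *\<^sub>R w \<in> lattice_points"
  then obtain i where i: "i \<le> d" "w = v i" by auto
  have "frac t *\<^sub>R v i = t *\<^sub>R v i - of_int \<lfloor>t\<rfloor> *\<^sub>R v i"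
    by (simp add: frac_def scaleR_left_diff_distrib)
  then have fL: "frac t *\<^sub>R v i \<in> lattice_points"
    using L i by (simp add: lattice_points_diff lattice_points_int v_lattice)
  have "frac t *\<^sub>R v i = 0"
  proof (rule canonical[OF fL])
    fix j assume j: "j \<le> d"
    have "frac t * b j < 1 * b j"
      using b_pos[OF j] frac_lt_1 by (intro mult_strict_right_mono) auto
    moreover have "0 \<le> frac t * of_bool (j = i)"
      by (simp add: frac_ge_0)
    ultimately show "- b j < y j (frac t *\<^sub>R v i)"
      unfolding y_scaleR y_vertex[OF j i(1)] right_diff_distrib by linarith
  qed
  moreover have "v i \<noteq> 0" using y_vertex[of i i] b_less_1[of i] i by auto
  ultimately have "frac t = 0" by simp
  then obtain k where k: "t = of_int k" by (auto simp: frac_eq_0_iff elim: Ints_cases)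
  have "(\<Sum>j\<le>d. of_int (k * of_bool (j = i)) *\<^sub>R v j) = t *\<^sub>R w"
    using i k by (subst sum.remove[of _ i]) auto
  then show "t *\<^sub>R w \<in> vertex_sublattice vertex_hull"
    unfolding vertex_sublattice_vertex_hull
    by (intro CollectI exI[of _ "\<lambda>j. k * of_bool (j = i)"]) simp
qed

lemma is_wps_quotient_vertex_hull:
  assumes "mset ws = mset (map lam [0..<Suc d])"
  shows "is_wps_quotient vertex_hull ws"
  unfolding is_wps_quotient_def
proof (intro conjI exI)
  define w where "w x = lam (inv_into {..d} v x)" for x
  have w: "w (v i) = lam i" if "i \<le> d" for i
    using inv_into_f_f[OF inj_on_v, of i] that by (simp add: w_def)
  have img: "w ` vertices vertex_hull = lam ` {..d}"
    unfolding vertices_vertex_hull image_image using w by (intro image_cong) auto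
  have "(\<Sum>i\<le>d. real (lam i) *\<^sub>R v i) = real h *\<^sub>R (\<Sum>i\<le>d. b i *\<^sub>R v i)"
    using h_pos by (simp add: scaleR_sum_right b_eq)
  then have "(\<Sum>i\<le>d. real (lam i) *\<^sub>R v i) = 0" by (simp add: sum_b_vertices)
  then have "(\<Sum>x\<in>vertices vertex_hull. real (w x) *\<^sub>R x) = 0"
    by (simp add: vertices_vertex_hull sum_image_v w)
  then show "reduced_weights vertex_hull w"
    unfolding reduced_weights_def img using Gcd_lam lam_pos w
    by (auto simp: vertices_vertex_hull)
  have "image_mset w (mset_set (vertices vertex_hull)) = image_mset w (image_mset v (mset_set {..d}))"
    unfolding vertices_vertex_hull using image_mset_mset_set[OF inj_on_v] by simp
  also have "\<dots> = image_mset lam (mset_set {..d})"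
    unfolding image_mset.compositionality using w by (intro image_mset_cong) auto
  also have "mset_set {..d} = mset [0..<Suc d]"
    by (simp only: mset_upt atLeast0_lessThan_Suc lessThan_atLeast0 lessThan_Suc_atMost[symmetric])
  finally show "image_mset w (mset_set (vertices vertex_hull)) = mset ws"
    using assms by simp
qed (intro comm_group_quotient_group finite_quotient_group fano_simplex_vertex_hull
    free_in_codim_one_vertex_hull)+

end

text \<open>
  In coordinates that identify the maximal lattice of the extremal case with \<open>\<int>\<^sup>d\<close>, the vertices are
  \<open>a i\<close> times the \<open>i\<close>-th unit vector minus the all-one vector, for \<open>i < d\<close>, and minus the
  all-one vector.
\<close>

locale unit_fraction_simplex =
  fixes a :: "nat \<Rightarrow> nat" and d :: nat and e :: "'n::finite \<Rightarrow> nat"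
  assumes e: "bij_betw e UNIV {..<d}"
    and a_pos: "i \<le> d \<Longrightarrow> 0 < a i"
    and a_dvd: "i \<le> d \<Longrightarrow> a i dvd a d"
    and a_sum: "(\<Sum>i\<le>d. 1 / real (a i)) = 1"
begin

definition f :: "nat \<Rightarrow> 'n" where
  "f = inv_into UNIV e"

lemma e_less: "e k < d"
  using bij_betwE[OF e] by auto

lemma f_e [simp]: "f (e k) = k"
  using bij_betw_inv_into_left[OF e] by (simp add: f_def)

lemma e_f [simp]: "i < d \<Longrightarrow> e (f i) = i"
  using bij_betw_inv_into_right[OF e] by (simp add: f_def)

definition vtx :: "nat \<Rightarrow> real ^ 'n" where
  "vtx i = (\<chi> k. (if e k = i then real (a i) else 0) - 1)"

definition co :: "nat \<Rightarrow> real ^ 'n \<Rightarrow> real" where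
  "co i x = (if i < d then x $ f i / real (a i) else - (\<Sum>j<d. x $ f j / real (a j)))"

lemma sum_head: "(\<Sum>i<d. 1 / real (a i)) = 1 - 1 / real (a d)"
  using a_sum by (simp add: lessThan_Suc_atMost[symmetric])

lemma b_a: "i \<le> d \<Longrightarrow> real (a d div a i) / real (a d) = 1 / real (a i)"
  using a_pos[of d] a_dvd[of i] by (simp add: real_of_nat_div)

sublocale canonical_simplex vtx co "\<lambda>i. real (a d div a i) / real (a d)" d "\<lambda>i. a d div a i" "a d"
proof (intro canonical_simplex.intro simplex_coordinates.intro canonical_simplex_axioms.intro)
  show "CARD('n) = d"
    using bij_betw_same_card[OF e] by simp
  show "linear (co i)" for i
    by (rule linearI)
      (auto simp: co_def add_divide_distrib sum.distrib scaleR_sum_right sum_distrib_left)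
  show "co i (vtx j) = of_bool (i = j) - real (a d div a i) / real (a d)" if "i \<le> d" "j \<le> d" for i j
  proof -
    have head: "vtx j $ f i / real (a i) = of_bool (i = j) - 1 / real (a i)" if "i < d" for i
      using that a_pos[of i] by (auto simp: vtx_def diff_divide_distrib)
    have "co i (vtx j) = of_bool (i = j) - 1 / real (a i)"
    proof (cases "i < d")
      case True
      then show ?thesis using head by (simp add: co_def)
    next
      case False
      then have "i = d" using \<open>i \<le> d\<close> by simp
      have "(\<Sum>i<d. vtx j $ f i / real (a i)) = (\<Sum>i<d. of_bool (i = j)) - (1 - 1 / real (a d))"
        by (simp add: head sum_subtractf sum_head)
      also have "(\<Sum>i<d. of_bool (i = j)) = (of_bool (j < d) :: real)"
        by (auto simp: of_bool_def sum.delta')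
      finally show ?thesis using \<open>i = d\<close> \<open>j \<le> d\<close> by (auto simp: co_def)
    qed
    then show ?thesis using b_a[OF that(1)] by simp
  qed
  show "(\<Sum>i\<le>d. co i x) = 0" for x
    by (simp add: co_def lessThan_Suc_atMost[symmetric])
  show "(\<Sum>i\<le>d. co i x *\<^sub>R vtx i) = x" for x
  proof (rule vec_eq_iff[THEN iffD2, rule_format])
    fix k
    have "(\<Sum>i\<le>d. co i x *\<^sub>R vtx i) $ k
        = (\<Sum>i\<le>d. co i x * (if e k = i then real (a i) else 0)) - (\<Sum>i\<le>d. co i x)"
      by (simp add: vtx_def right_diff_distrib sum_subtractf)
    also have "(\<Sum>i\<le>d. co i x) = 0"
      by (simp add: co_def lessThan_Suc_atMost[symmetric])
    also have "(\<Sum>i\<le>d. co i x * (if e k = i then real (a i) else 0)) = co (e k) x * real (a (e k))"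
      using e_less[of k] by (subst sum.remove[of _ "e k"]) auto
    also have "\<dots> = x $ k"
      using e_less[of k] a_pos[of "e k"] by (simp add: co_def)
    finally show "(\<Sum>i\<le>d. co i x *\<^sub>R vtx i) $ k = x $ k" by simp
  qed
  show "0 < real (a d div a i) / real (a d)" if "i \<le> d" for i
    unfolding b_a[OF that] using a_pos[OF that] by simp
  show "(\<Sum>i\<le>d. real (a d div a i) / real (a d)) = 1"
    using a_sum b_a by simp
  show "vtx i \<in> lattice_points" for i
    by (auto simp: vtx_def lattice_points_def)
  have ad: "0 < a d" using a_pos by simp
  have div: "real (a d div a i) = real (a d) / real (a i)" if "i \<le> d" for i
    using a_dvd[OF that] by (rule real_of_nat_div)
  have "real (\<Sum>i\<le>d. a d div a i) = real (a d) * (\<Sum>i\<le>d. 1 / real (a i))"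
    by (simp add: div sum_distrib_left)
  then show "a d = (\<Sum>i\<le>d. a d div a i)" using a_sum by (metis mult.right_neutral of_nat_eq_iff)
  show "real (a d div a i) / real (a d) = real (a d div a i) / real (a d)" for i ..
  \<comment> \<open>The last weight is 1, which makes the weights coprime.\<close>
  have "a d div a d \<in> (\<lambda>i. a d div a i) ` {..d}" by blast
  then have "Gcd ((\<lambda>i. a d div a i) ` {..d}) dvd a d div a d" by (rule Gcd_dvd)
  then show "Gcd ((\<lambda>i. a d div a i) ` {..d}) = 1" using ad by simp
  \<comment> \<open>The first \<open>d\<close> inequalities say that the integral entries exceed -1,
    so they are nonnegative. The last one says that the sum of all \<open>x $ f j / a j\<close> is
    below \<open>1 / a d\<close>; a single positive entry violates this, since
    \<open>a i \<le> a d\<close>.\<close>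
  show "x = 0" if x: "x \<in> lattice_points" and less: "\<And>i. i \<le> d \<Longrightarrow> - (real (a d div a i) / real (a d)) < co i x" for x
  proof -
    have nonneg: "0 \<le> x $ f i" if "i < d" for i
    proof -
      have "- (1 / real (a i)) < x $ f i / real (a i)" using less[of i] that b_a[of i] by (simp add: co_def)
      then have "real (a i) * - (1 / real (a i)) < real (a i) * (x $ f i / real (a i))"
        using a_pos[of i] that by (intro mult_strict_left_mono) auto
      then have "-1 < x $ f i" using a_pos[of i] that by simp
      moreover obtain m where "x $ f i = of_int m" using x by (auto simp: lattice_points_def elim: Ints_cases)
      ultimately show ?thesis by simp
    qed
    have "x $ f i = 0" if i: "i < d" for i
    proof (rule ccontr)
      assume "x $ f i \<noteq> 0"
      moreover obtain m where "x $ f i = of_int m" using x by (auto simp: lattice_points_def elim: Ints_cases)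
      ultimately have 1: "1 \<le> x $ f i" using nonneg[OF i] by simp
      have "a i \<le> a d" using a_dvd[of i] ad i by (intro dvd_imp_le) auto
      then have "1 / real (a d) \<le> 1 / real (a i)"
        using a_pos[of i] i by (intro divide_left_mono) auto
      also have "\<dots> \<le> x $ f i / real (a i)" using 1 by (intro divide_right_mono) auto
      also have "\<dots> \<le> (\<Sum>j<d. x $ f j / real (a j))"
        using i nonneg by (intro member_le_sum) auto
      finally show False using less[of d] b_a[of d] by (simp add: co_def)
    qed
    then have "x $ k = 0" for k using e_less[of k] f_e by metis
    then show ?thesis by (simp add: vec_eq_iff)
  qed
qed

text \<open>The sublattice is spanned by \<open>a i\<close> times the \<open>i\<close>-th unit
  vector, for \<open>i < d\<close>, and the all-one vector. So the quotient is the product of the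
  cyclic groups of order \<open>a i\<close> modulo the subgroup generated by (1, ..., 1), whose
  order is at most \<open>a d\<close> because each \<open>a i\<close> divides \<open>a d\<close>.
  For the extremal denominators the general bound supplies the opposite inequality.\<close>

lemma prod_le_multiplicity: "(\<Prod>i<d. a i) \<le> a d * fwps_multiplicity vertex_hull"
proof -
  obtain X where X: "X \<subseteq> lattice_points" "finite X" "card X = fwps_multiplicity vertex_hull"
    "\<And>x. x \<in> lattice_points \<Longrightarrow> \<exists>r\<in>X. x - r \<in> vertex_sublattice vertex_hull"
    using coset_representatives[OF fano_simplex_vertex_hull] by metis
  define F where "F = (\<lambda>(r :: real ^ 'n, k). \<lambda>i\<in>{..<d}. (\<lfloor>r $ f i\<rfloor> + int k) mod int (a i))"
  have "PiE {..<d} (\<lambda>i. {0..<int (a i)}) \<subseteq> F ` (X \<times> {..<a d})"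
  proof
    fix t assume t: "t \<in> PiE {..<d} (\<lambda>i. {0..<int (a i)})"
    define z :: "real ^ 'n" where "z = (\<chi> k. of_int (t (e k)))"
    have "z \<in> lattice_points" by (simp add: z_def lattice_points_def)
    then obtain r where r: "r \<in> X" "z - r \<in> vertex_sublattice vertex_hull" using X(4) by blast
    then obtain c where c: "z - r = (\<Sum>j\<le>d. of_int (c j) *\<^sub>R vtx j)"
      by (auto simp: vertex_sublattice_vertex_hull)
    define S where "S = (\<Sum>j\<le>d. c j)"
    \<comment> \<open>Every vertex contributes its coefficient times the negative of the all-one
      vector, a shift by \<open>- S\<close> in total; modulo every \<open>a i\<close> it depends
      only on its residue modulo \<open>a d\<close>.\<close>
    define k where "k = nat ((- S) mod int (a d))"
    have ad: "0 < a d" using a_pos by simp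
    have k: "k < a d" "int k = (- S) mod int (a d)" using ad by (simp_all add: k_def nat_less_iff)
    have "t i = F (r, k) i" if i: "i < d" for i
    proof -
      have "of_int (t i) - r $ f i = (z - r) $ f i" using i by (simp add: z_def)
      also have "\<dots> = (\<Sum>j\<le>d. of_int (c j) * (if i = j then real (a j) else 0)) - (\<Sum>j\<le>d. of_int (c j))"
        unfolding c using i by (simp add: vtx_def right_diff_distrib sum_subtractf)
      also have "(\<Sum>j\<le>d. of_int (c j) * (if i = j then real (a j) else 0)) = of_int (c i) * real (a i)"
        using i by (subst sum.remove[of _ i]) auto
      finally have "r $ f i = of_int (t i - c i * int (a i) + S)" by (simp add: S_def)
      then have fl: "\<lfloor>r $ f i\<rfloor> = t i - c i * int (a i) + S" by (metis floor_of_int)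
      have "int (a i) dvd int (a d)" using a_dvd[of i] i by simp
      moreover have "int k mod int (a d) = (- S) mod int (a d)" by (simp add: k(2))
      then have "int (a d) dvd int k + S" by (simp add: mod_eq_dvd_iff)
      ultimately have "int (a i) dvd int k + S" by (rule dvd_trans)
      then have "int (a i) dvd (int k + S) - c i * int (a i)" by (intro dvd_diff) auto
      also have "(int k + S) - c i * int (a i) = (\<lfloor>r $ f i\<rfloor> + int k) - t i"
        unfolding fl by simp
      finally have "int (a i) dvd (\<lfloor>r $ f i\<rfloor> + int k) - t i" .
      then have "(\<lfloor>r $ f i\<rfloor> + int k) mod int (a i) = t i mod int (a i)"
        by (simp add: mod_eq_dvd_iff)
      also have "\<dots> = t i" using PiE_mem[OF t, of i] i by simp
      finally show ?thesis using i by (simp add: F_def)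
    qed
    moreover have "F (r, k) \<in> extensional {..<d}" by (simp add: F_def)
    ultimately have "t = F (r, k)"
      using t by (intro extensionalityI[of t "{..<d}"]) (auto simp: PiE_def)
    then show "t \<in> F ` (X \<times> {..<a d})" using r k by auto
  qed
  then have "card (PiE {..<d} (\<lambda>i. {0..<int (a i)})) \<le> card (X \<times> {..<a d})"
    using X(2) by (intro surj_card_le) auto
  then show ?thesis by (simp add: card_PiE card_cartesian_product X(3) mult.commute)
qed

end


section \<open>Simplices of maximal multiplicity\<close>

text \<open>Affine independence makes the relation between the vertices unique up to a factor. An
  integral relation divided by its greatest common divisor gives the weights, and normalising their
  sum to 1 gives \<open>b\<close>; the vertices are then listed by nonincreasing weight.\<close>

lemma canonical_fano_simplex_sorted:
  fixes P :: "(real ^ 'n::finite) set"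
  assumes "canonical_fano_simplex P"
  obtains v y b lam h where "sorted_canonical_simplex v y b CARD('n) lam h"
    and "P = convex hull (v ` {..CARD('n)})"
proof -
  let ?d = "CARD('n)"
  have fano: "fano_simplex P" and int: "interior P \<inter> lattice_points = {0}"
    using assms by (auto simp: canonical_fano_simplex_def)
  obtain C where C: "\<not> affine_dependent C" "int (card C) = int ?d + 1" "P = convex hull C"
    using fano by (auto simp: fano_simplex_def simplex_def)
  have finC: "finite C" using C(1) by (rule aff_independent_finite)
  have cardC: "card C = Suc ?d" using C(2) by simp
  have "vertices P = C"
    using C by (auto simp: vertices_def extreme_point_of_convex_hull_affine_independent)
  then have CL: "C \<subseteq> lattice_points"
    using fano by (auto simp: fano_simplex_def primitive_point_def)
  have "0 \<in> interior (convex hull C)" using fano C by (simp add: fano_simplex_def)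
  then obtain \<beta> where \<beta>: "\<And>v. v \<in> C \<Longrightarrow> 0 < \<beta> v" "sum \<beta> C = 1" "(\<Sum>v\<in>C. \<beta> v *\<^sub>R v) = 0"
    using cardC unfolding interior_convex_hull_explicit_minimal[OF C(1)] by auto
  have unique: "\<forall>v\<in>C. c v = sum c C * \<beta> v" if "(\<Sum>v\<in>C. c v *\<^sub>R v) = 0" for c
  proof (rule ccontr)
    define u where "u v = c v - sum c C * \<beta> v" for v
    assume "\<not> ?thesis"
    then have "\<exists>v\<in>C. u v \<noteq> 0" by (auto simp: u_def)
    moreover have "sum u C = 0" by (simp add: u_def sum_subtractf \<beta>(2) flip: sum_distrib_left)
    moreover have "(\<Sum>v\<in>C. u v *\<^sub>R v) = (\<Sum>v\<in>C. c v *\<^sub>R v) - sum c C *\<^sub>R (\<Sum>v\<in>C. \<beta> v *\<^sub>R v)"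
      by (simp add: u_def scaleR_left_diff_distrib sum_subtractf scaleR_sum_right)
    then have "(\<Sum>v\<in>C. u v *\<^sub>R v) = 0" using that \<beta>(3) by simp
    ultimately show False using C(1) affine_dependent_explicit_finite[OF finC] by blast
  qed
  have neC: "C \<noteq> {}" using cardC by auto
  obtain w where w: "\<forall>v\<in>C. 0 < w v" "(\<Sum>v\<in>C. real (w v) *\<^sub>R v) = 0"
    using integral_relation[OF finC neC CL \<beta>(1,3) unique] by blast
  define g where "g = Gcd (w ` C)"
  define l where "l v = w v div g" for v
  have gl: "w v = g * l v" if "v \<in> C" for v
    using that Gcd_dvd[of "w v" "w ` C"] by (simp add: l_def g_def)
  have g: "0 < g" using w(1) gl neC by (metis all_not_in_conv gr0I mult_0 less_irrefl)
  have lpos: "0 < l v" if "v \<in> C" for v using w(1) gl that by (metis gr0I less_irrefl mult_0_right)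
  have "g = Gcd ((*) g ` (l ` C))"
    unfolding g_def[symmetric] image_image using gl by (simp add: g_def cong: image_cong)
  also have "\<dots> = g * Gcd (l ` C)" by (subst Gcd_mult) simp
  finally have Gcd_l: "Gcd (l ` C) = 1" using g by simp
  define H where "H = (\<Sum>v\<in>C. l v)"
  have l_\<beta>: "\<beta> v = real (l v) / real H" if v: "v \<in> C" for v
  proof -
    have "(\<Sum>v\<in>C. real (w v)) = real g * real H"
      by (simp add: H_def sum_distrib_left gl)
    moreover have "real (w v) = (\<Sum>v\<in>C. real (w v)) * \<beta> v" using unique[OF w(2)] v by blast
    ultimately have "real g * real (l v) = real g * (real H * \<beta> v)" using gl[OF v] by simp
    then have "real (l v) = real H * \<beta> v" using g by simp
    moreover have "H \<noteq> 0" using lpos[OF v] v finC by (auto simp: H_def)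
    ultimately show ?thesis by simp
  qed
  obtain xs0 where xs0: "set xs0 = C" "distinct xs0" using finite_distinct_list[OF finC] by blast
  \<comment> \<open>The negated integer key turns the ascending sort into a descending one.\<close>
  define xs where "xs = sort_key (\<lambda>v. - int (l v)) xs0"
  have xs: "set xs = C" "distinct xs" "sorted (map (\<lambda>v. - int (l v)) xs)"
    using xs0 by (simp_all add: xs_def)
  have len: "length xs = Suc ?d" using xs cardC distinct_card by metis
  have bij: "bij_betw (nth xs) {..?d} C"
    using bij_betw_nth[OF xs(2), of "{..?d}" C] xs(1) len by (auto simp: lessThan_Suc_atMost)
  define v where "v = nth xs"
  define lam where "lam i = l (v i)" for i
  define b where "b i = real (lam i) / real H" for i
  have vC: "v i \<in> C" if "i \<le> ?d" for i using bij_betwE[OF bij] that by (simp add: v_def)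
  have sum_C: "(\<Sum>x\<in>C. q x) = (\<Sum>i\<le>?d. q (v i))" for q :: "real ^ 'n \<Rightarrow> 'c::comm_monoid_add"
    using sum.reindex_bij_betw[OF bij, of q] by (simp add: v_def)
  have b\<beta>: "b i = \<beta> (v i)" if "i \<le> ?d" for i using l_\<beta>[OF vC[OF that]] by (simp add: b_def lam_def)
  have img: "v ` {..?d} = C" using bij by (simp add: bij_betw_def v_def)
  obtain y where y: "simplex_coordinates v y b ?d"
  proof (rule simplex_coordinates_exist[of ?d v b])
    show "inj_on v {..?d}" using bij by (simp add: bij_betw_def v_def)
    show "(\<Sum>i\<le>?d. b i) = 1" using \<beta>(2) by (simp add: sum_C b\<beta>)
    show "(\<Sum>i\<le>?d. b i *\<^sub>R v i) = 0" using \<beta>(3) by (simp add: sum_C b\<beta>)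
    show "\<forall>i\<le>?d. c i = (\<Sum>i\<le>?d. c i) * b i" if c: "(\<Sum>i\<le>?d. c i *\<^sub>R v i) = 0" for c
    proof -
      define c' where "c' x = c (inv_into {..?d} v x)" for x
      have c': "c' (v i) = c i" if "i \<le> ?d" for i
        using bij_betw_inv_into_left[OF bij, of i] that by (simp add: c'_def v_def)
      have "\<forall>v\<in>C. c' v = sum c' C * \<beta> v"
        using c by (intro unique) (simp add: sum_C c')
      then show ?thesis using vC b\<beta> c' by (simp add: sum_C)
    qed
  qed (use \<beta>(1) vC b\<beta> in auto)
  interpret S: simplex_coordinates v y b ?d by (rule y)
  have hull: "P = S.vertex_hull" using C(3) img by (simp add: S.vertex_hull_def)
  have "sorted_canonical_simplex v y b ?d lam H"
  proof (intro sorted_canonical_simplex.intro canonical_simplex.intro canonical_simplex_axioms.intro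
      sorted_canonical_simplex_axioms.intro y)
    show "v i \<in> lattice_points" if "i \<le> ?d" for i using vC[OF that] CL by auto
    show "H = (\<Sum>i\<le>?d. lam i)" by (simp add: H_def sum_C lam_def)
    show "b i = real (lam i) / real H" for i by (simp add: b_def)
    have "lam ` {..?d} = l ` v ` {..?d}" unfolding image_image lam_def by simp
    then show "Gcd (lam ` {..?d}) = 1" using Gcd_l img by simp
    show "x = 0" if "x \<in> lattice_points" "\<And>i. i \<le> ?d \<Longrightarrow> - b i < y i x" for x
      using that int unfolding hull S.interior_vertex_hull by blast
    show "lam j \<le> lam i" if "i \<le> j" "j \<le> ?d" for i j
      using sorted_nth_mono[OF xs(3), of i j] that len by (simp add: lam_def v_def)
  qed
  then show ?thesis using C(3) img by (intro that) auto
qed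

lemma multiplicity_le:
  fixes P :: "(real ^ 'n::finite) set"
  assumes "canonical_fano_simplex P"
  shows "fwps_multiplicity P \<le> max_mult CARD('n)"
proof -
  obtain v y b lam h where S: "sorted_canonical_simplex v y b CARD('n) lam h"
    and P: "P = convex hull (v ` {..CARD('n)})"
    using canonical_fano_simplex_sorted[OF assms] by metis
  interpret sorted_canonical_simplex v y b "CARD('n)" lam h by (rule S)
  show ?thesis using lattice_index_le by (simp add: lattice_index_def vertex_hull_def P)
qed

text \<open>In the extremal case the lattice is determined by the coordinates and \<open>b\<close>,
  and \<open>b\<close> depends on the dimension only.\<close>

lemma maximal_multiplicity_isomorphic:
  fixes P Q :: "(real ^ 'n::finite) set"
  assumes P: "canonical_fano_simplex P" "fwps_multiplicity P = max_mult CARD('n)"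
    and Q: "canonical_fano_simplex Q" "fwps_multiplicity Q = max_mult CARD('n)"
  shows "fwps_isomorphic P Q"
proof -
  let ?d = "CARD('n)"
  have *: "\<exists>v y b. simplex_coordinates v y b ?d \<and> R = convex hull (v ` {..?d}) \<and>
      (\<forall>i\<le>?d. b i = 1 / real (extremal_denominator ?d i)) \<and>
      (\<forall>x. x \<in> lattice_points \<longleftrightarrow> (\<forall>i<?d. y i x / b i \<in> \<int>))"
    if R: "canonical_fano_simplex R" "fwps_multiplicity R = max_mult ?d" for R :: "(real ^ 'n) set"
  proof -
    obtain v y b lam h where S: "sorted_canonical_simplex v y b ?d lam h"
      and R': "R = convex hull (v ` {..?d})"
      using canonical_fano_simplex_sorted[OF R(1)] by metis
    interpret sorted_canonical_simplex v y b ?d lam h by (rule S)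
    have "lattice_index = max_mult ?d" using R(2) by (simp add: lattice_index_def vertex_hull_def R')
    then show ?thesis
      using lattice_index_eq lattice_points_iff_if_maximal simplex_coordinates_axioms R' by blast
  qed
  obtain v y b where 1: "simplex_coordinates v y b ?d" "P = convex hull (v ` {..?d})"
    "\<forall>i\<le>?d. b i = 1 / real (extremal_denominator ?d i)"
    "\<forall>x. x \<in> lattice_points \<longleftrightarrow> (\<forall>i<?d. y i x / b i \<in> \<int>)"
    using *[OF P] by blast
  obtain v' y' b' where 2: "simplex_coordinates v' y' b' ?d" "Q = convex hull (v' ` {..?d})"
    "\<forall>i\<le>?d. b' i = 1 / real (extremal_denominator ?d i)"
    "\<forall>x. x \<in> lattice_points \<longleftrightarrow> (\<forall>i<?d. y' i x / b' i \<in> \<int>)"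
    using *[OF Q] by blast
  show ?thesis
    unfolding 1(2) 2(2)
  proof (rule vertex_hull_isomorphic[OF 1(1) 2(1)])
    show "b i = b' i" if "i \<le> ?d" for i using 1(3) 2(3) that by simp
  qed (use 1(4) 2(4) in blast)+
qed

section \<open>Arithmetic of the extremal denominators and existence of the extremal simplex\<close>

lemma sylvester_dvd_prod: "i < k \<Longrightarrow> sylvester (Suc i) dvd sylvester_prod k"
  unfolding sylvester_prod_def by (intro dvd_prodI) auto

lemma head_length_less: "0 < d \<Longrightarrow> head_length d < d"
  by (auto simp: head_length_def)

lemma sum_inverse_extremal_denominator:
  assumes "0 < d"
  shows "(\<Sum>i\<le>d. 1 / real (extremal_denominator d i)) = 1"
proof -
  define k where "k = head_length d"
  have k: "k < d" using head_length_less[OF assms] by (simp add: k_def)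
  have "{..d} = {..<k} \<union> {k..d}" using k by auto
  then have "(\<Sum>i\<le>d. 1 / real (extremal_denominator d i))
      = (\<Sum>i<k. 1 / real (extremal_denominator d i)) + (\<Sum>i=k..d. 1 / real (extremal_denominator d i))"
    by (simp add: sum.union_disjoint ivl_disj_int)
  also have "(\<Sum>i<k. 1 / real (extremal_denominator d i)) = 1 - sylvester_rest k"
    unfolding sum_inverse_sylvester[symmetric] by (simp add: extremal_denominator_def k_def)
  also have "(\<Sum>i=k..d. 1 / real (extremal_denominator d i)) = sylvester_rest k"
    using k by (simp add: extremal_denominator_def sylvester_rest_def k_def[symmetric])
  finally show ?thesis by simp
qed

text \<open>Turns the count of residues for the extremal denominators into the lower bound
  \<open>max_mult d\<close> for the multiplicity.\<close>

lemma prod_extremal_denominator: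
  assumes "0 < d"
  shows "(\<Prod>i<d. extremal_denominator d i) = extremal_denominator d d * max_mult d"
proof -
  define k where "k = head_length d"
  have k: "k < d" using head_length_less[OF assms] by (simp add: k_def)
  define H where "H = (d + 1 - k) * sylvester_prod k"
  have "(\<Prod>i<d. extremal_denominator d i) = (\<Prod>i<k. extremal_denominator d i) * (\<Prod>i=k..<d. extremal_denominator d i)"
    using prod.atLeastLessThan_concat[of 0 k d "extremal_denominator d"] k by (simp add: lessThan_atLeast0)
  also have "(\<Prod>i<k. extremal_denominator d i) = sylvester_prod k"
    by (simp add: extremal_denominator_def k_def[symmetric] sylvester_prod_def prod.atLeast1_atMost_eq)
  also have "(\<Prod>i=k..<d. extremal_denominator d i) = H ^ (d - k)"
    by (simp add: extremal_denominator_def k_def[symmetric] H_def)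
  also have "d - k = Suc (d - 1 - k)" using k by simp
  finally show ?thesis
    using k by (simp add: extremal_denominator_def max_mult_def k_def[symmetric] H_def mult_ac)
qed

lemma maximal_multiplicity_exists:
  obtains P :: "(real ^ 'n::finite) set" where "canonical_fano_simplex P"
    and "fwps_multiplicity P = max_mult CARD('n)"
    and "\<And>ws. mset ws = mset (map (\<lambda>i. extremal_denominator CARD('n) CARD('n) div
        extremal_denominator CARD('n) i) [0..<Suc CARD('n)]) \<Longrightarrow> is_wps_quotient P ws"
proof -
  let ?d = "CARD('n)"
  have d: "0 < ?d" by simp
  define a where "a = extremal_denominator ?d"
  obtain e :: "'n \<Rightarrow> nat" where e: "bij_betw e UNIV {0..<?d}"
    using ex_bij_betw_finite_nat[of "UNIV :: 'n set"] by auto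
  have a_pos: "0 < a i" for i
    using head_length_less[OF d] sylvester_prod_pos
    by (simp add: a_def extremal_denominator_def sylvester_Suc)
  interpret unit_fraction_simplex a ?d e
  proof
    show "bij_betw e UNIV {..<?d}" using e by (simp add: lessThan_atLeast0)
    show "a i dvd a ?d" for i
      using head_length_less[OF d] sylvester_dvd_prod[of i "head_length ?d"]
      by (auto simp: a_def extremal_denominator_def)
    show "(\<Sum>i\<le>?d. 1 / real (a i)) = 1"
      unfolding a_def by (rule sum_inverse_extremal_denominator[OF d])
  qed (rule a_pos)
  have "a ?d * max_mult ?d \<le> a ?d * fwps_multiplicity vertex_hull"
    using prod_le_multiplicity prod_extremal_denominator[OF d] by (simp add: a_def)
  then have "max_mult ?d \<le> fwps_multiplicity vertex_hull" using a_pos[of ?d] by simp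
  then have "fwps_multiplicity vertex_hull = max_mult ?d"
    using multiplicity_le[OF canonical_fano_simplex_vertex_hull] by simp
  then show ?thesis
    using that[OF canonical_fano_simplex_vertex_hull] is_wps_quotient_vertex_hull
    by (simp add: a_def)
qed

lemma max_mult_values:
  shows "0 < d \<Longrightarrow> d \<le> 3 \<Longrightarrow> max_mult d = (d + 1) ^ (d - 1)"
    and "max_mult 4 = 128"
    and "5 \<le> d \<Longrightarrow> max_mult d = 3 * (sylvester (d - 1) - 1)\<^sup>2"
proof -
  show "max_mult d = (d + 1) ^ (d - 1)" if "0 < d" "d \<le> 3"
    using that by (simp add: max_mult_def head_length_def)
  show "max_mult 4 = 128"
    by (simp add: max_mult_def head_length_def sylvester_prod_Suc)
  show "max_mult d = 3 * (sylvester (d - 1) - 1)\<^sup>2" if d: "5 \<le> d"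
  proof -
    have "d - 1 = Suc (d - 2)" using d by simp
    then have "sylvester (d - 1) - 1 = sylvester_prod (d - 2)" by (simp only: sylvester_Suc)
    moreover have "d + 1 - (d - 2) = 3" "d - 1 - (d - 2) = 1" using d by simp_all
    ultimately show ?thesis using d by (simp add: max_mult_def head_length_def power2_eq_square)
  qed
qed

lemma extremal_weights:
  shows "d \<le> 3 \<Longrightarrow> map (\<lambda>i. extremal_denominator d d div extremal_denominator d i) [0..<Suc d]
      = replicate (d + 1) 1"
    and "map (\<lambda>i. extremal_denominator 4 4 div extremal_denominator 4 i) [0..<Suc 4] = [4, 1, 1, 1, 1]"
    and "5 \<le> d \<Longrightarrow> map (\<lambda>i. extremal_denominator d d div extremal_denominator d i) [0..<Suc d]
      = sylvester_weights d"
proof -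
  show "map (\<lambda>i. extremal_denominator d d div extremal_denominator d i) [0..<Suc d] = replicate (d + 1) 1"
    if "d \<le> 3"
  proof -
    have "map (\<lambda>i. extremal_denominator d d div extremal_denominator d i) [0..<Suc d] = map (\<lambda>i. 1) [0..<Suc d]"
      using that by (intro map_cong) (auto simp: extremal_denominator_def head_length_def)
    then show ?thesis by (simp only: map_replicate_const length_upt) simp
  qed
  show "map (\<lambda>i. extremal_denominator 4 4 div extremal_denominator 4 i) [0..<Suc 4] = [4, 1, 1, 1, 1]"
    by (simp add: extremal_denominator_def head_length_def sylvester_prod_Suc sylvester_Suc upt_rec
        flip: numeral_2_eq_2)
  show "map (\<lambda>i. extremal_denominator d d div extremal_denominator d i) [0..<Suc d] = sylvester_weights d"
    if d: "5 \<le> d"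
  proof -
    obtain n where n: "d = n + 2" using that[of "d - 2"] d by simp
    have hl: "head_length d = n" using n d by (simp add: head_length_def)
    have s: "sylvester (d - 1) - 1 = sylvester_prod n"
      using sylvester_Suc[of n] by (simp add: n)
    have ed: "extremal_denominator d i = (if i < n then sylvester (Suc i) else 3 * sylvester_prod n)" for i
      unfolding extremal_denominator_def hl by (simp add: n)
    have edd: "extremal_denominator d d = 3 * sylvester_prod n" unfolding ed by (simp add: n)
    have upt: "[0..<Suc d] = [0..<n] @ [n, n + 1, n + 2]" by (simp add: n)
    have head: "map (\<lambda>i. extremal_denominator d d div extremal_denominator d i) [0..<n]
        = map (\<lambda>i. 3 * sylvester_prod n div sylvester i) (map Suc [0..<n])"
      unfolding map_map edd by (intro map_cong) (auto simp: ed)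
    have "map Suc [0..<n] = [1..<d - 1]" by (simp add: map_Suc_upt n)
    then show ?thesis
      unfolding sylvester_weights_def s upt map_append head
      using sylvester_prod_pos[of n] by (simp add: edd ed[of n] ed[of "Suc n"] ed[of "Suc (Suc n)"])
  qed
qed

theorem theorem1p1:
  fixes d :: nat
  assumes "d = CARD('n::finite)"
  shows
    "(d \<le> 3 \<longrightarrow>
        (\<forall>P :: (real ^ 'n) set. canonical_fano_simplex P \<longrightarrow>
           fwps_multiplicity P \<le> (d + 1) ^ (d - 1)) \<and>
        (\<exists>P :: (real ^ 'n) set. canonical_fano_simplex P \<and>
           fwps_multiplicity P = (d + 1) ^ (d - 1) \<and>
           is_wps_quotient P (replicate (d + 1) 1) \<and>
           (\<forall>Q :: (real ^ 'n) set. canonical_fano_simplex Q \<and>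
              fwps_multiplicity Q = (d + 1) ^ (d - 1) \<longrightarrow> fwps_isomorphic Q P))) \<and>
     (d = 4 \<longrightarrow>
        (\<forall>P :: (real ^ 'n) set. canonical_fano_simplex P \<longrightarrow> fwps_multiplicity P \<le> 128) \<and>
        (\<exists>P :: (real ^ 'n) set. canonical_fano_simplex P \<and>
           fwps_multiplicity P = 128 \<and>
           is_wps_quotient P [4, 1, 1, 1, 1] \<and>
           (\<forall>Q :: (real ^ 'n) set. canonical_fano_simplex Q \<and>
              fwps_multiplicity Q = 128 \<longrightarrow> fwps_isomorphic Q P))) \<and>
     (d \<ge> 5 \<longrightarrow>
        (\<forall>P :: (real ^ 'n) set. canonical_fano_simplex P \<longrightarrow>
           fwps_multiplicity P \<le> 3 * (sylvester (d - 1) - 1)\<^sup>2) \<and>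
        (\<exists>P :: (real ^ 'n) set. canonical_fano_simplex P \<and>
           fwps_multiplicity P = 3 * (sylvester (d - 1) - 1)\<^sup>2 \<and>
           is_wps_quotient P (sylvester_weights d) \<and>
           (\<forall>Q :: (real ^ 'n) set. canonical_fano_simplex Q \<and>
              fwps_multiplicity Q = 3 * (sylvester (d - 1) - 1)\<^sup>2 \<longrightarrow> fwps_isomorphic Q P)))"
proof -
  \<comment> \<open>The three cases differ only in the closed forms of the bound and of the
    weights.\<close>
  have main: "(\<forall>P :: (real ^ 'n) set. canonical_fano_simplex P \<longrightarrow> fwps_multiplicity P \<le> m) \<and>
      (\<exists>P :: (real ^ 'n) set. canonical_fano_simplex P \<and> fwps_multiplicity P = m \<and>
        is_wps_quotient P ws \<and>
        (\<forall>Q :: (real ^ 'n) set. canonical_fano_simplex Q \<and> fwps_multiplicity Q = m \<longrightarrow>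
          fwps_isomorphic Q P))"
    if "max_mult d = m"
      and "map (\<lambda>i. extremal_denominator d d div extremal_denominator d i) [0..<Suc d] = ws" for m ws
  proof -
    obtain P :: "(real ^ 'n) set" where P: "canonical_fano_simplex P"
      "fwps_multiplicity P = max_mult CARD('n)"
      "\<And>ws. mset ws = mset (map (\<lambda>i. extremal_denominator CARD('n) CARD('n) div
        extremal_denominator CARD('n) i) [0..<Suc CARD('n)]) \<Longrightarrow> is_wps_quotient P ws"
      using maximal_multiplicity_exists by blast
    show ?thesis
      unfolding that(1)[symmetric] that(2)[symmetric] assms
    proof (intro conjI allI impI exI[of _ P])
      show "fwps_multiplicity P' \<le> max_mult CARD('n)" if "canonical_fano_simplex P'" for P' :: "(real ^ 'n) set"
        using that by (rule multiplicity_le)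
      show "is_wps_quotient P (map (\<lambda>i. extremal_denominator CARD('n) CARD('n) div
        extremal_denominator CARD('n) i) [0..<Suc CARD('n)])"
        by (rule P(3)) (rule refl)
    qed (use P maximal_multiplicity_isomorphic in blast)+
  qed
  have d: "0 < d" using assms by simp
  show ?thesis
  proof (rule conjI[OF impI conjI[OF impI impI]], goal_cases)
    case 1
    then show ?case by (intro main max_mult_values(1) extremal_weights(1) d)
  next
    case 2
    show ?case unfolding 2 by (intro main[unfolded 2] max_mult_values(2) extremal_weights(2))
  next
    case 3
    then show ?case by (intro main max_mult_values(3) extremal_weights(3))
  qed
qed

end
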